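(* Let $d\ge 2$ and let $D$ be a fixed $d$-ary tree with at least two leaves, with branches $D_1,D_2,\ldots,D_d$ (some of them possibly empty). Then $$I_d(D)\le\binom{\|D\|}{\|D_1\|,\|D_2\|,\ldots,\|D_d\|}\Big(\prod_{i=1}^d I_d(D_i)\Big)\sup_{\substack{0\le x_1,x_2,\ldots,x_d<1\\ x_1+x_2+\cdots+x_d=1}}Z_D(x_1,x_2,\ldots,x_d),$$ where $$Z_D(x_1,x_2,\ldots,x_d)=\frac{1}{1-\sum_{i=1}^d x_i^{\|D\|}}\sum_{\pi\in M(D)}\ \prod_{j=1}^d x_j^{\|D_{\pi(j)}\|}.$$
   Context: A $d$-ary tree is a finite rooted tree in which every internal (non-leaf) vertex has at least two and at most $d$ children; a single vertex is a $d$-ary tree with one leaf, and the empty tree with $0$ leaves is also allowed. Isomorphism means root-preserving isomorphism (two empty trees are isomorphic). $\|T\|$ denotes the number of leaves of $T$. A set $S$ of leaves of $T$ induces a $d$-ary tree: take the smallest subtree of $T$ containing all leaves in $S$ (rooted at the most recent common ancestor of $S$) and repeatedly suppress every vertex with exactly one child (contracting its two adjacent edges to a single edge). $c(D,T)$ is the number of sets of $\|D\|$ leaves of $T$ that induce a tree isomorphic to $D$, and $\gamma(D,T)=c(D,T)/\binom{\|T\|}{\|D\|}$. The $d$-ary inducibility of a nonempty $d$-ary tree $D$ is $$I_d(D)=\limsup_{n\to\infty}\ \max_{\substack{\|T\|=n\\ T\ d\text{-ary tree}}}\gamma(D,T),$$ and $I_d(D)=1$ if $D$ is empty. The branches of a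 $d$-ary tree $D$ with at least two leaves are the components (rooted at the children of the root) obtained on removing the root; the list is padded with empty trees to have exactly $d$ entries $D_1,\ldots,D_d$. On the set of permutations of $[d]=\{1,\ldots,d\}$ define $\pi\sim_D\pi'$ if $D_{\pi(j)}$ is isomorphic to $D_{\pi'(j)}$ for every $j\in[d]$; $M(D)$ is a complete set of representatives of the equivalence classes of $\sim_D$. The convention $0^0=1$ is used. *)

theory Defs
  imports
    "HOL-Library.Extended_Real"
    "HOL-Library.Sublist"
    "HOL-Combinatorics.Permutations"
begin

(* Finite rooted trees are presented with a (mathematically irrelevant) order on the
   children of each vertex; None is the empty tree. A vertex is addressed by the path of
   child indices leading to it from the root, so the root is []. *)

datatype rtree = Node (children: "rtree list")

type_synonym dtree = "rtree option"

primrec is_vertex :: "rtree \<Rightarrow> nat list \<Rightarrow> bool" where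
  "is_vertex t [] = True"
| "is_vertex t (i # v) = (i < length (children t) \<and> is_vertex (children t ! i) v)"

primrec subtree_at :: "rtree \<Rightarrow> nat list \<Rightarrow> rtree" where
  "subtree_at t [] = t"
| "subtree_at t (i # v) = subtree_at (children t ! i) v"

fun tree_vertices :: "dtree \<Rightarrow> nat list set" where
  "tree_vertices None = {}"
| "tree_vertices (Some t) = {v. is_vertex t v}"

fun tree_leaves :: "dtree \<Rightarrow> nat list set" where
  "tree_leaves None = {}"
| "tree_leaves (Some t) = {v. is_vertex t v \<and> children (subtree_at t v) = []}"

definition num_leaves :: "dtree \<Rightarrow> nat" where
  "num_leaves T = card (tree_leaves T)"

fun dary :: "nat \<Rightarrow> dtree \<Rightarrow> bool" where
  "dary d None = True"
| "dary d (Some t) = (\<forall>v. is_vertex t v \<and> children (subtree_at t v) \<noteq> [] \<longrightarrow>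
     2 \<le> length (children (subtree_at t v)) \<and> length (children (subtree_at t v)) \<le> d)"

definition tree_adjacent :: "nat list \<Rightarrow> nat list \<Rightarrow> bool" where
  "tree_adjacent u v \<longleftrightarrow> (\<exists>i. v = u @ [i] \<or> u = v @ [i])"

(* For two empty trees the bijection condition is void, and it fails if exactly one of the
   trees is empty. *)
definition tree_iso :: "dtree \<Rightarrow> dtree \<Rightarrow> bool" where
  "tree_iso T U \<longleftrightarrow> (\<exists>\<phi>. bij_betw \<phi> (tree_vertices T) (tree_vertices U) \<and> \<phi> [] = [] \<and>
     (\<forall>u \<in> tree_vertices T. \<forall>v \<in> tree_vertices T.
        tree_adjacent (\<phi> u) (\<phi> v) \<longleftrightarrow> tree_adjacent u v))"

(* Keeps exactly the root and the vertices having a descendant (or themselves) in S. *)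
function prune :: "rtree \<Rightarrow> nat list set \<Rightarrow> rtree" where
  "prune (Node ts) S =
     Node (map (\<lambda>i. prune (ts ! i) {v. i # v \<in> S})
               (filter (\<lambda>i. \<exists>v. i # v \<in> S) [0..<length ts]))"
  by pat_completeness auto
termination
  by (relation "measure (size \<circ> fst)") (auto simp: less_Suc_eq_le intro!: size_list_estimation'[OF nth_mem])

(* The most recent common ancestor of S is the longest common prefix of the addresses in S;
   the smallest subtree containing S is rooted there. *)
definition spanning_subtree :: "rtree \<Rightarrow> nat list set \<Rightarrow> rtree" where
  "spanning_subtree t S =
     (let m = Longest_common_prefix S in prune (subtree_at t m) {v. m @ v \<in> S})"

fun suppress_unary :: "rtree \<Rightarrow> rtree" where
  "suppress_unary (Node ts) =
     (case map suppress_unary ts of [u] \<Rightarrow> u | us \<Rightarrow> Node us)"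

definition induced_tree :: "dtree \<Rightarrow> nat list set \<Rightarrow> dtree" where
  "induced_tree T S =
     (case T of None \<Rightarrow> None
      | Some t \<Rightarrow> if S = {} then None else Some (suppress_unary (spanning_subtree t S)))"

definition tree_count :: "dtree \<Rightarrow> dtree \<Rightarrow> nat" where
  "tree_count D T =
     card {S. S \<subseteq> tree_leaves T \<and> card S = num_leaves D \<and> tree_iso (induced_tree T S) D}"

definition tree_density :: "dtree \<Rightarrow> dtree \<Rightarrow> real" where
  "tree_density D T = real (tree_count D T) / real (num_leaves T choose num_leaves D)"

(* The densities lie in [0, 1], so the extended-real limsup is finite. *)
fun inducibility :: "nat \<Rightarrow> dtree \<Rightarrow> real" where
  "inducibility d None = 1"
| "inducibility d (Some t) = real_of_ereal (limsup (\<lambda>n.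
     ereal (MAX T \<in> {T. dary d T \<and> num_leaves T = n}. tree_density (Some t) T)))"

(* Branches are numbered from 0 to d - 1. Only meant for D with at least two leaves:
   in particular the empty tree has no root to remove. *)
definition branch :: "nat \<Rightarrow> dtree \<Rightarrow> nat \<Rightarrow> dtree" where
  "branch d D i =
     (let ts = children (the D) in (map Some ts @ replicate (d - length ts) None) ! i)"

definition branch_equiv :: "nat \<Rightarrow> dtree \<Rightarrow> (nat \<Rightarrow> nat) \<Rightarrow> (nat \<Rightarrow> nat) \<Rightarrow> bool" where
  "branch_equiv d D \<pi> \<pi>' \<longleftrightarrow> (\<forall>j<d. tree_iso (branch d D (\<pi> j)) (branch d D (\<pi>' j)))"

definition complete_representatives :: "nat \<Rightarrow> dtree \<Rightarrow> (nat \<Rightarrow> nat) set \<Rightarrow> bool" where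
  "complete_representatives d D M \<longleftrightarrow>
     M \<subseteq> {\<pi>. \<pi> permutes {..<d}} \<and>
     (\<forall>\<pi>. \<pi> permutes {..<d} \<longrightarrow> (\<exists>!\<rho>. \<rho> \<in> M \<and> branch_equiv d D \<pi> \<rho>))"

definition Z_fun :: "nat \<Rightarrow> dtree \<Rightarrow> (nat \<Rightarrow> nat) set \<Rightarrow> (nat \<Rightarrow> real) \<Rightarrow> real" where
  "Z_fun d D M x =
     1 / (1 - (\<Sum>i<d. x i ^ num_leaves D)) *
     (\<Sum>\<pi>\<in>M. \<Prod>j<d. x j ^ num_leaves (branch d D (\<pi> j)))"

end

theory Submission
  imports Defs "HOL-Real_Asymp.Real_Asymp"
begin

text \<open>Write \<open>m = \<parallel>D\<parallel>\<close>. A copy of \<open>D\<close> in \<open>T\<close> either lies within a single branch of \<open>T\<close> or meets every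
  branch \<open>T\<^sub>j\<close> in a copy of \<open>D\<^bsub>\<pi>(j)\<^esub>\<close> for exactly one \<open>\<pi> \<in> M(D)\<close>, so
  \<open>c(D,T) = \<Sum>\<^sub>j c(D,T\<^sub>j) + \<Sum>\<^sub>\<pi> \<Prod>\<^sub>j c(D\<^bsub>\<pi>(j)\<^esub>,T\<^sub>j)\<close>.
  This recurrence has two uses. First, replacing every leaf of \<open>T\<close> by a tree with \<open>k\<close> leaves multiplies
  \<open>c(D,T)\<close> by at least \<open>k\<^sup>m\<close>, so letting \<open>k\<close> grow gives the error-free bound
  \<open>c(D,T) \<le> I(D) \<parallel>T\<parallel>\<^sup>m / m!\<close> for all \<open>T\<close>. Second, with this bound applied to the branches of \<open>D\<close> and
  \<open>x\<^sub>j = \<parallel>T\<^sub>j\<parallel> / \<parallel>T\<parallel>\<close>, induction on \<open>T\<close> gives \<open>c(D,T) \<le> K \<parallel>T\<parallel>\<^sup>m\<close> with \<open>K\<close> the claimed bound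
  divided by \<open>m!\<close>: the induction step is exactly the inequality \<open>Z\<^sub>D(x) \<le> sup Z\<^sub>D\<close>.\<close>

declare tree_leaves.simps(2) [simp del] inducibility.simps(2) [simp del]

lemma tree_leaves_Nil: "tree_leaves (Some (Node [])) = {[]}"
proof -
  have "is_vertex (Node []) v \<longleftrightarrow> v = []" for v by (cases v) auto
  then show ?thesis by (simp add: tree_leaves.simps(2) set_eq_iff cong: conj_cong)
qed

lemma tree_leaves_Node:
  assumes "ts \<noteq> []"
  shows "tree_leaves (Some (Node ts)) = (\<Union>i<length ts. Cons i ` tree_leaves (Some (ts ! i)))"
proof -
  have "v \<in> tree_leaves (Some (Node ts)) \<longleftrightarrow>
      v \<in> (\<Union>i<length ts. Cons i ` tree_leaves (Some (ts ! i)))" for v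
    using assms by (cases v) (auto simp: tree_leaves.simps(2))
  then show ?thesis by blast
qed

lemma finite_tree_leaves: "finite (tree_leaves T)"
proof (cases T)
  case (Some t)
  have "finite (tree_leaves (Some t))"
  proof (induction t)
    case (Node ts)
    show ?case
    proof (cases "ts = []")
      case True
      then show ?thesis by (simp add: tree_leaves_Nil)
    next
      case False
      then show ?thesis
        using Node.IH unfolding tree_leaves_Node[OF False] by (intro finite_UN_I finite_imageI) auto
    qed
  qed
  with Some show ?thesis by simp
qed simp

lemma num_leaves_None [simp]: "num_leaves None = 0"
  by (simp add: num_leaves_def)

lemma num_leaves_Nil [simp]: "num_leaves (Some (Node [])) = 1"
  by (simp add: num_leaves_def tree_leaves_Nil)

lemma num_leaves_Node:
  assumes "ts \<noteq> []"
  shows "num_leaves (Some (Node ts)) = (\<Sum>i<length ts. num_leaves (Some (ts ! i)))"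
proof -
  have "num_leaves (Some (Node ts)) =
      (\<Sum>i<length ts. card (Cons i ` tree_leaves (Some (ts ! i))))"
    unfolding num_leaves_def tree_leaves_Node[OF assms]
    by (rule card_UN_disjoint) (auto simp: finite_tree_leaves)
  then show ?thesis
    by (simp add: card_image num_leaves_def)
qed

lemma num_leaves_pos: "1 \<le> num_leaves (Some t)"
proof (induction t)
  case (Node ts)
  show ?case
  proof (cases "ts = []")
    case False
    have "1 \<le> num_leaves (Some (ts ! 0))"
      using Node False by simp
    also have "\<dots> \<le> (\<Sum>i<length ts. num_leaves (Some (ts ! i)))"
      using False by (intro member_le_sum) auto
    finally show ?thesis
      using False by (simp add: num_leaves_Node)
  qed simp
qed

lemma dary_Node:
  "dary d (Some (Node ts)) \<longleftrightarrow>
    (ts \<noteq> [] \<longrightarrow> 2 \<le> length ts \<and> length ts \<le> d) \<and> (\<forall>i<length ts. dary d (Some (ts ! i)))"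
  (is "?l \<longleftrightarrow> ?r")
proof
  assume l: ?l
  have "dary d (Some (ts ! i))" if "i < length ts" for i
    unfolding dary.simps
  proof (intro allI impI)
    fix v assume "is_vertex (ts ! i) v \<and> children (subtree_at (ts ! i) v) \<noteq> []"
    then show "2 \<le> length (children (subtree_at (ts ! i) v)) \<and>
        length (children (subtree_at (ts ! i) v)) \<le> d"
      using l[unfolded dary.simps, rule_format, of "i # v"] that by simp
  qed
  then show ?r
    using l[unfolded dary.simps, rule_format, of "[]"] by simp
next
  assume r: ?r
  show ?l
    unfolding dary.simps
  proof (intro allI impI)
    fix v assume "is_vertex (Node ts) v \<and> children (subtree_at (Node ts) v) \<noteq> []"
    then show "2 \<le> length (children (subtree_at (Node ts) v)) \<and>
        length (children (subtree_at (Node ts) v)) \<le> d"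
      using r by (cases v) auto
  qed
qed

declare dary.simps(2) [simp del]

section \<open>Isomorphism of rooted trees\<close>

lemma tree_iso_refl: "tree_iso T T"
  unfolding tree_iso_def by (rule exI[of _ id]) simp

lemma tree_iso_sym:
  assumes "tree_iso T U" shows "tree_iso U T"
proof -
  obtain \<phi> where b: "bij_betw \<phi> (tree_vertices T) (tree_vertices U)" and r: "\<phi> [] = []"
    and a: "\<forall>u \<in> tree_vertices T. \<forall>v \<in> tree_vertices T. tree_adjacent (\<phi> u) (\<phi> v) \<longleftrightarrow> tree_adjacent u v"
    using assms unfolding tree_iso_def by blast
  have e: "tree_vertices T = {} \<or> [] \<in> tree_vertices T" by (cases T) auto
  have e': "tree_vertices T = {} \<longleftrightarrow> tree_vertices U = {}"
    using b by (auto simp: bij_betw_def)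
  define \<psi> where "\<psi> v = (if v = [] then [] else inv_into (tree_vertices T) \<phi> v)" for v
  have eq: "\<psi> v = inv_into (tree_vertices T) \<phi> v" if "v \<in> tree_vertices U" for v
    using e e' r that bij_betw_inv_into_left[OF b, of "[]"] by (auto simp: \<psi>_def)
  have m: "\<psi> v \<in> tree_vertices T" "\<phi> (\<psi> v) = v" if "v \<in> tree_vertices U" for v
    unfolding eq[OF that]
    using bij_betwE[OF bij_betw_inv_into[OF b]] bij_betw_inv_into_right[OF b] that by auto
  have "bij_betw \<psi> (tree_vertices U) (tree_vertices T)"
    using bij_betw_inv_into[OF b] bij_betw_cong[of "tree_vertices U" \<psi>] eq by blast
  moreover have "tree_adjacent (\<psi> u) (\<psi> v) \<longleftrightarrow> tree_adjacent u v"
    if "u \<in> tree_vertices U" "v \<in> tree_vertices U" for u v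
    using a m[OF that(1)] m[OF that(2)] by metis
  ultimately show ?thesis
    unfolding tree_iso_def by (intro exI[of _ \<psi>]) (simp add: \<psi>_def)
qed

lemma tree_iso_trans:
  assumes "tree_iso T U" "tree_iso U V" shows "tree_iso T V"
proof -
  obtain \<phi> where 1: "bij_betw \<phi> (tree_vertices T) (tree_vertices U)" "\<phi> [] = []"
    "\<forall>u \<in> tree_vertices T. \<forall>v \<in> tree_vertices T. tree_adjacent (\<phi> u) (\<phi> v) \<longleftrightarrow> tree_adjacent u v"
    using assms(1) unfolding tree_iso_def by blast
  obtain \<psi> where 2: "bij_betw \<psi> (tree_vertices U) (tree_vertices V)" "\<psi> [] = []"
    "\<forall>u \<in> tree_vertices U. \<forall>v \<in> tree_vertices U. tree_adjacent (\<psi> u) (\<psi> v) \<longleftrightarrow> tree_adjacent u v"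
    using assms(2) unfolding tree_iso_def by blast
  show ?thesis
    unfolding tree_iso_def
    using bij_betw_trans[OF 1(1) 2(1)] 1 2 bij_betwE[OF 1(1)]
    by (intro exI[of _ "\<psi> \<circ> \<phi>"]) auto
qed

lemma tree_iso_None_iff:
  assumes "tree_iso T U" shows "T = None \<longleftrightarrow> U = None"
proof -
  have "tree_vertices X = {} \<longleftrightarrow> X = None" for X
    by (cases X) (auto intro!: exI[of _ "[]"])
  moreover have "tree_vertices T = {} \<longleftrightarrow> tree_vertices U = {}"
    using assms by (auto simp: tree_iso_def bij_betw_def)
  ultimately show ?thesis by blast
qed

lemma tree_adjacent_Cons [simp]: "tree_adjacent (i # u) (j # v) \<longleftrightarrow> i = j \<and> tree_adjacent u v"
  by (auto simp: tree_adjacent_def)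

lemma tree_adjacent_Nil [simp]:
  "tree_adjacent [] v \<longleftrightarrow> length v = 1" "tree_adjacent v [] \<longleftrightarrow> length v = 1"
  by (auto simp: tree_adjacent_def length_Suc_conv)

lemma is_vertex_appendD: "is_vertex t (u @ v) \<Longrightarrow> is_vertex t u"
  by (induction u arbitrary: t) auto

text \<open>An isomorphism preserves depth, hence maps each branch onto a branch.\<close>

lemma tree_iso_Node:
  "tree_iso (Some (Node us)) (Some (Node ds)) \<longleftrightarrow>
    (\<exists>f. bij_betw f {..<length us} {..<length ds} \<and>
      (\<forall>i<length us. tree_iso (Some (us ! i)) (Some (ds ! f i))))"
  (is "?l \<longleftrightarrow> ?r")
proof
  let ?V = "{v. is_vertex (Node us) v}" and ?W = "{v. is_vertex (Node ds) v}"
  assume ?l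
  then obtain \<phi> where b: "bij_betw \<phi> ?V ?W" and r: "\<phi> [] = []"
    and a: "\<And>u v. u \<in> ?V \<Longrightarrow> v \<in> ?V \<Longrightarrow> tree_adjacent (\<phi> u) (\<phi> v) \<longleftrightarrow> tree_adjacent u v"
    unfolding tree_iso_def tree_vertices.simps by blast
  have inj: "inj_on \<phi> ?V" and im: "\<phi> ` ?V = ?W" using b by (auto simp: bij_betw_def)
  have snoc: "\<exists>j. \<phi> (u @ [i]) = \<phi> u @ [j]" if "u @ [i] \<in> ?V" for u i
    using that
  proof (induction u arbitrary: i rule: rev_induct)
    case Nil
    then have "tree_adjacent (\<phi> [i]) (\<phi> [])" using a[of "[i]" "[]"] by simp
    then show ?case by (auto simp: r length_Suc_conv)
  next
    case (snoc k w)
    let ?u = "w @ [k]"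
    have V: "?u \<in> ?V" "w \<in> ?V"
      using snoc.prems is_vertex_appendD[of "Node us" ?u] is_vertex_appendD[of "Node us" w] by auto
    obtain l where l: "\<phi> ?u = \<phi> w @ [l]" using snoc.IH V by blast
    have "tree_adjacent (\<phi> (?u @ [i])) (\<phi> ?u)"
      using a[OF snoc.prems V(1)] by (auto simp: tree_adjacent_def)
    then consider j where "\<phi> (?u @ [i]) = \<phi> ?u @ [j]" | j where "\<phi> ?u = \<phi> (?u @ [i]) @ [j]"
      unfolding tree_adjacent_def by blast
    then show ?case
    proof cases
      case 2
      then have "\<phi> w = \<phi> (?u @ [i])" using l by simp
      then have "w = ?u @ [i]" using inj_onD[OF inj _ V(2) snoc.prems] by blast
      then have "length w = length (?u @ [i])" by (rule arg_cong)
      then show ?thesis by simp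
    qed blast
  qed
  define f where "f i = hd (\<phi> [i])" for i
  define \<psi> where "\<psi> i w = tl (\<phi> (i # w))" for i w
  have f1: "\<phi> [i] = [f i]" if "[i] \<in> ?V" for i
    using snoc[of "[]" i] that r by (auto simp: f_def)
  have ph: "\<phi> (i # w) = f i # \<psi> i w" if "i # w \<in> ?V" for i w
  proof -
    have "\<exists>w'. \<phi> (i # w) = f i # w'"
      using that
    proof (induction w rule: rev_induct)
      case Nil
      then show ?case using f1 by simp
    next
      case (snoc k w)
      then have "(i # w) @ [k] \<in> ?V" by simp
      moreover from this have "i # w \<in> ?V"
        using is_vertex_appendD[of "Node us" "i # w" "[k]"] by blast
      ultimately show ?case
        using snoc.IH \<open>\<And>u i. u @ [i] \<in> ?V \<Longrightarrow> \<exists>j. \<phi> (u @ [i]) = \<phi> u @ [j]\<close>[of "i # w" k] by auto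
    qed
    then show ?thesis by (auto simp: \<psi>_def)
  qed
  have sing: "[i] \<in> ?V \<longleftrightarrow> i < length us" "[i] \<in> ?W \<longleftrightarrow> i < length ds" for i by auto
  have pre: "\<exists>i w. v = i # w \<and> i # w \<in> ?V \<and> j = f i \<and> w' = \<psi> i w \<and> i < length us \<and> is_vertex (us ! i) w"
    if "v \<in> ?V" "\<phi> v = j # w'" for v j w'
  proof (cases v)
    case Nil
    then show ?thesis using that r by simp
  next
    case (Cons i w)
    then show ?thesis using that ph[of i w] by auto
  qed
  have injf: "inj_on f {..<length us}"
  proof (rule inj_onI)
    fix i j assume *: "i \<in> {..<length us}" "j \<in> {..<length us}" "f i = f j"
    then have "\<phi> [i] = \<phi> [j]" using f1 sing by auto
    then show "i = j" using inj_onD[OF inj, of "[i]" "[j]"] sing * by auto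
  qed
  have fW: "f i < length ds" if "i < length us" for i
    using im f1[of i] sing that by (metis imageI)
  have "f ` {..<length us} = {..<length ds}"
  proof (intro equalityI subsetI)
    fix j assume "j \<in> {..<length ds}"
    then have "[j] \<in> ?W" by simp
    then obtain v where "v \<in> ?V" "\<phi> v = [j]" using im by (metis (no_types, lifting) imageE)
    then show "j \<in> f ` {..<length us}" using pre[of v j "[]"] by auto
  qed (use fW in auto)
  then have bf: "bij_betw f {..<length us} {..<length ds}" using injf by (simp add: bij_betw_def)
  have "tree_iso (Some (us ! i)) (Some (ds ! f i))" if i: "i < length us" for i
  proof -
    have V: "i # w \<in> ?V \<longleftrightarrow> is_vertex (us ! i) w" for w using i by simp
    have "bij_betw (\<psi> i) {v. is_vertex (us ! i) v} {v. is_vertex (ds ! f i) v}"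
      unfolding bij_betw_def
    proof (intro conjI equalityI subsetI)
      show "inj_on (\<psi> i) {v. is_vertex (us ! i) v}"
      proof (rule inj_onI)
        fix v w assume *: "v \<in> {v. is_vertex (us ! i) v}" "w \<in> {v. is_vertex (us ! i) v}" "\<psi> i v = \<psi> i w"
        then have "\<phi> (i # v) = \<phi> (i # w)" using ph[of i v] ph[of i w] i by simp
        then show "v = w" using inj_onD[OF inj, of "i # v" "i # w"] i * by simp
      qed
    next
      fix w' assume "w' \<in> {v. is_vertex (ds ! f i) v}"
      then have "f i # w' \<in> ?W" using fW i by simp
      then obtain v where v: "v \<in> ?V" "\<phi> v = f i # w'" using im by (metis (no_types, lifting) imageE)
      obtain i' w where "f i = f i'" "w' = \<psi> i' w" "i' < length us" "is_vertex (us ! i') w"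
        using pre[OF v] by blast
      moreover from this have "i' = i" using inj_onD[OF injf, of i i'] i by simp
      ultimately show "w' \<in> \<psi> i ` {v. is_vertex (us ! i) v}" by auto
    next
      fix w' assume "w' \<in> \<psi> i ` {v. is_vertex (us ! i) v}"
      then obtain w where w: "is_vertex (us ! i) w" "w' = \<psi> i w" by auto
      then have "\<phi> (i # w) \<in> ?W" using im V by blast
      then show "w' \<in> {v. is_vertex (ds ! f i) v}" using ph[of i w] i w by simp
    qed
    moreover have "\<psi> i [] = []" using f1[of i] i by (simp add: \<psi>_def)
    moreover have "tree_adjacent (\<psi> i u) (\<psi> i v) \<longleftrightarrow> tree_adjacent u v"
      if "is_vertex (us ! i) u" "is_vertex (us ! i) v" for u v
      using a[of "i # u" "i # v"] ph[of i u] ph[of i v] i that by simp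
    ultimately show ?thesis
      unfolding tree_iso_def by (intro exI[of _ "\<psi> i"]) auto
  qed
  with bf show ?r by blast
next
  assume ?r
  then obtain f where bf: "bij_betw f {..<length us} {..<length ds}"
    and "\<forall>i<length us. tree_iso (Some (us ! i)) (Some (ds ! f i))" by blast
  then have "\<forall>i. \<exists>\<phi>. i < length us \<longrightarrow> bij_betw \<phi> {v. is_vertex (us ! i) v} {v. is_vertex (ds ! f i) v} \<and>
      \<phi> [] = [] \<and> (\<forall>u v. is_vertex (us ! i) u \<longrightarrow> is_vertex (us ! i) v \<longrightarrow>
        (tree_adjacent (\<phi> u) (\<phi> v) \<longleftrightarrow> tree_adjacent u v))"
    unfolding tree_iso_def by fastforce
  then obtain \<chi> where "\<forall>i. i < length us \<longrightarrow>
      bij_betw (\<chi> i) {v. is_vertex (us ! i) v} {v. is_vertex (ds ! f i) v} \<and>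
      \<chi> i [] = [] \<and> (\<forall>u v. is_vertex (us ! i) u \<longrightarrow> is_vertex (us ! i) v \<longrightarrow>
        (tree_adjacent (\<chi> i u) (\<chi> i v) \<longleftrightarrow> tree_adjacent u v))"
    by (rule choice[THEN exE])
  then have bx: "\<And>i. i < length us \<Longrightarrow> bij_betw (\<chi> i) {v. is_vertex (us ! i) v} {v. is_vertex (ds ! f i) v}"
    and rx: "\<And>i. i < length us \<Longrightarrow> \<chi> i [] = []"
    and ax: "\<And>i u v. i < length us \<Longrightarrow> is_vertex (us ! i) u \<Longrightarrow> is_vertex (us ! i) v \<Longrightarrow>
        tree_adjacent (\<chi> i u) (\<chi> i v) \<longleftrightarrow> tree_adjacent u v"
    by blast+
  let ?V = "{v. is_vertex (Node us) v}" and ?W = "{v. is_vertex (Node ds) v}"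
  define \<phi> where "\<phi> v = (case v of [] \<Rightarrow> [] | i # w \<Rightarrow> f i # \<chi> i w)" for v
  have [simp]: "\<phi> [] = []" "\<phi> (i # w) = f i # \<chi> i w" for i w by (simp_all add: \<phi>_def)
  have injx: "\<chi> i u = \<chi> i v \<longleftrightarrow> u = v"
    if "i < length us" "is_vertex (us ! i) u" "is_vertex (us ! i) v" for i u v
    using bij_betw_imp_inj_on[OF bx[OF that(1)]] that by (auto dest: inj_onD)
  have injf: "f i = f j \<longleftrightarrow> i = j" if "i < length us" "j < length us" for i j
    using bij_betw_imp_inj_on[OF bf] that by (auto dest: inj_onD)
  have nil: "\<chi> i u = [] \<longleftrightarrow> u = []" if "i < length us" "is_vertex (us ! i) u" for i u
    using injx[OF that, of "[]"] rx[OF that(1)] by simp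
  have "inj_on \<phi> ?V"
  proof (rule inj_onI)
    fix u v assume "u \<in> ?V" "v \<in> ?V" "\<phi> u = \<phi> v"
    then show "u = v" by (cases u; cases v) (auto simp: injf injx)
  qed
  moreover have "\<phi> ` ?V = ?W"
  proof (intro equalityI subsetI)
    fix v assume "v \<in> \<phi> ` ?V"
    then obtain u where u: "u \<in> ?V" "v = \<phi> u" by blast
    then show "v \<in> ?W"
      using bij_betwE[OF bf] bij_betwE[OF bx] by (cases u) auto
  next
    fix v assume v: "v \<in> ?W"
    show "v \<in> \<phi> ` ?V"
    proof (cases v)
      case Nil
      then show ?thesis by (intro image_eqI[of _ _ "[]"]) auto
    next
      case (Cons j w)
      then have "j \<in> f ` {..<length us}" using v bf by (auto simp: bij_betw_def)
      then obtain i where i: "i < length us" "j = f i" by auto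
      then have "w \<in> \<chi> i ` {v. is_vertex (us ! i) v}"
        using v Cons bx[OF i(1)] by (auto simp: bij_betw_def)
      then obtain u where "is_vertex (us ! i) u" "w = \<chi> i u" by auto
      with i Cons show ?thesis by (intro image_eqI[of _ _ "i # u"]) auto
    qed
  qed
  moreover have "tree_adjacent (\<phi> u) (\<phi> v) \<longleftrightarrow> tree_adjacent u v" if "u \<in> ?V" "v \<in> ?V" for u v
    using that by (cases u; cases v) (auto simp: injf ax nil)
  ultimately show ?l
    unfolding tree_iso_def by (intro exI[of _ \<phi>]) (auto simp: bij_betw_def)
qed

lemma tree_iso_num_leaves:
  assumes "tree_iso T U" shows "num_leaves T = num_leaves U"
proof (cases T)
  case None
  then show ?thesis using tree_iso_None_iff[OF assms] by simp
next
  case (Some t)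
  then obtain u where U: "U = Some u" using tree_iso_None_iff[OF assms] by auto
  have "num_leaves (Some t) = num_leaves (Some u)" if "tree_iso (Some t) (Some u)"
    using that
  proof (induction t arbitrary: u)
    case (Node ts)
    obtain us where u: "u = Node us" by (cases u)
    obtain f where f: "bij_betw f {..<length ts} {..<length us}"
      and i: "\<And>i. i < length ts \<Longrightarrow> tree_iso (Some (ts ! i)) (Some (us ! f i))"
      using Node.prems unfolding u tree_iso_Node by blast
    have len: "length ts = length us" using bij_betw_same_card[OF f] by simp
    show ?case
    proof (cases "ts = []")
      case False
      then have "us \<noteq> []" using len by auto
      have "(\<Sum>i<length ts. num_leaves (Some (ts ! i))) = (\<Sum>i<length ts. num_leaves (Some (us ! f i)))"
        using Node.IH i by (intro sum.cong) auto
      also have "\<dots> = (\<Sum>i<length us. num_leaves (Some (us ! i)))"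
        using sum.reindex_bij_betw[OF f, of "\<lambda>i. num_leaves (Some (us ! i))"] .
      finally show ?thesis using False \<open>us \<noteq> []\<close> by (simp add: u num_leaves_Node)
    qed (use len u in simp)
  qed
  then show ?thesis using assms Some U by simp
qed

lemma branch_Node:
  assumes "length ts \<le> d" "i < d"
  shows "branch d (Some (Node ts)) i = (if i < length ts then Some (ts ! i) else None)"
  using assms by (auto simp: branch_def nth_append)

lemma tree_leaves_branch:
  assumes "ts \<noteq> []" "length ts \<le> d"
  shows "tree_leaves (Some (Node ts)) = (\<Union>j<d. Cons j ` tree_leaves (branch d (Some (Node ts)) j))"
proof -
  have "(\<Union>j<d. Cons j ` tree_leaves (branch d (Some (Node ts)) j)) =
      (\<Union>j<d. if j < length ts then Cons j ` tree_leaves (Some (ts ! j)) else {})"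
    using assms by (intro SUP_cong) (auto simp: branch_Node)
  also have "\<dots> = (\<Union>j<length ts. Cons j ` tree_leaves (Some (ts ! j)))"
    using assms(2) by (fastforce split: if_splits)
  finally show ?thesis
    using tree_leaves_Node[OF assms(1)] by simp
qed

lemma num_leaves_branch:
  assumes "ts \<noteq> []" "length ts \<le> d"
  shows "num_leaves (Some (Node ts)) = (\<Sum>j<d. num_leaves (branch d (Some (Node ts)) j))"
proof -
  have "num_leaves (Some (Node ts)) =
      (\<Sum>j<d. card (Cons j ` tree_leaves (branch d (Some (Node ts)) j)))"
    unfolding num_leaves_def tree_leaves_branch[OF assms]
    by (rule card_UN_disjoint) (auto simp: finite_tree_leaves)
  then show ?thesis
    by (simp add: card_image num_leaves_def)
qed

lemma tree_iso_Node_branch: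
  fixes X :: "nat \<Rightarrow> dtree"
  assumes "length ds \<le> d"
  shows "tree_iso (Some (Node (map (\<lambda>j. the (X j)) (filter (\<lambda>j. X j \<noteq> None) [0..<d])))) (Some (Node ds)) \<longleftrightarrow>
    (\<exists>\<pi>. \<pi> permutes {..<d} \<and> (\<forall>j<d. tree_iso (X j) (branch d (Some (Node ds)) (\<pi> j))))"
    (is "tree_iso (Some (Node ?us)) ?D \<longleftrightarrow> ?r")
proof -
  let ?js = "filter (\<lambda>j. X j \<noteq> None) [0..<d]"
  define J where "J = {j. j < d \<and> X j \<noteq> None}"
  define g where "g k = ?js ! k" for k
  have len: "length ?us = length ?js" by simp
  have sj: "set ?js = J" by (auto simp: J_def)
  have bg: "bij_betw g {..<length ?us} J"
    unfolding g_def[abs_def] len using sj by (intro bij_betw_nth) auto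
  have us: "Some (?us ! k) = X (g k)" if "k < length ?us" for k
  proof -
    have "g k \<in> J" using bij_betwE[OF bg] that by auto
    then show ?thesis using that by (auto simp: J_def g_def)
  qed
  have J: "J \<subseteq> {..<d}" "finite J" by (auto simp: J_def)
  show ?thesis
  proof
    assume "tree_iso (Some (Node ?us)) ?D"
    then obtain f where bf: "bij_betw f {..<length ?us} {..<length ds}"
      and f: "\<And>k. k < length ?us \<Longrightarrow> tree_iso (Some (?us ! k)) (Some (ds ! f k))"
      unfolding tree_iso_Node by blast
    define h where "h = f \<circ> inv_into {..<length ?us} g"
    have bh: "bij_betw h J {..<length ds}"
      unfolding h_def using bij_betw_inv_into[OF bg] bf by (rule bij_betw_trans)
    have h: "tree_iso (X j) (Some (ds ! h j))" if "j \<in> J" for j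
    proof -
      let ?k = "inv_into {..<length ?us} g j"
      have k: "?k < length ?us" "g ?k = j"
        using bij_betwE[OF bij_betw_inv_into[OF bg]] bij_betw_inv_into_right[OF bg] that by auto
      then show ?thesis using f[OF k(1)] us[OF k(1)] by (simp add: h_def)
    qed
    have "card ({..<d} - J) = card ({..<d} - {..<length ds})"
      using bij_betw_same_card[OF bh] J assms by (simp add: card_Diff_subset)
    then obtain e where be: "bij_betw e ({..<d} - J) ({..<d} - {..<length ds})"
      using finite_same_card_bij[of "{..<d} - J" "{..<d} - {..<length ds}"] by auto
    define \<pi> where "\<pi> j = (if j \<in> J then h j else if j < d then e j else j)" for j
    have "bij_betw \<pi> J {..<length ds}"
      using bh by (rule bij_betw_cong[THEN iffD1, rotated]) (auto simp: \<pi>_def)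
    moreover have "bij_betw \<pi> ({..<d} - J) ({..<d} - {..<length ds})"
      using be by (rule bij_betw_cong[THEN iffD1, rotated]) (auto simp: \<pi>_def)
    ultimately have "bij_betw \<pi> (J \<union> ({..<d} - J)) ({..<length ds} \<union> ({..<d} - {..<length ds}))"
      by (rule bij_betw_combine) auto
    moreover have "J \<union> ({..<d} - J) = {..<d}" "{..<length ds} \<union> ({..<d} - {..<length ds}) = {..<d}"
      using J assms by auto
    ultimately have "bij_betw \<pi> {..<d} {..<d}" by simp
    then have "\<pi> permutes {..<d}"
      by (rule bij_imp_permutes) (use J in \<open>auto simp: \<pi>_def\<close>)
    moreover have "tree_iso (X j) (branch d ?D (\<pi> j))" if "j < d" for j
    proof (cases "j \<in> J")
      case True
      then have "h j < length ds" using bij_betwE[OF bh] by auto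
      then show ?thesis using h[OF True] True assms by (simp add: \<pi>_def branch_Node)
    next
      case False
      then have "e j \<in> {..<d} - {..<length ds}" using bij_betwE[OF be] that by auto
      then show ?thesis using False that assms
        by (auto simp: \<pi>_def branch_Node J_def tree_iso_refl)
    qed
    ultimately show ?r by blast
  next
    assume ?r
    then obtain \<pi> where p: "\<pi> permutes {..<d}"
      and i: "\<And>j. j < d \<Longrightarrow> tree_iso (X j) (branch d ?D (\<pi> j))" by blast
    have pd: "\<pi> j < d \<longleftrightarrow> j < d" for j using permutes_in_image[OF p, of j] by simp
    have iff: "j \<in> J \<longleftrightarrow> \<pi> j < length ds" for j
    proof (cases "j < d")
      case True
      then show ?thesis
        using tree_iso_None_iff[OF i[OF True]] assms pd[of j]
        by (auto simp: J_def branch_Node split: if_splits)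
    next
      case False
      then show ?thesis using pd[of j] assms by (auto simp: J_def)
    qed
    have "\<pi> ` J = {..<length ds}"
    proof (intro equalityI subsetI)
      fix l assume l: "l \<in> {..<length ds}"
      obtain j where "\<pi> j = l" using permutes_surj[OF p] by (metis surjD)
      then show "l \<in> \<pi> ` J" using iff[of j] l by auto
    qed (use iff in auto)
    then have "bij_betw \<pi> J {..<length ds}"
      using permutes_inj_on[OF p] by (simp add: bij_betw_def)
    then have "bij_betw (\<pi> \<circ> g) {..<length ?us} {..<length ds}"
      using bg by (rule bij_betw_trans[rotated])
    moreover have "tree_iso (Some (?us ! k)) (Some (ds ! (\<pi> \<circ> g) k))" if "k < length ?us" for k
    proof -
      have "g k \<in> J" using bij_betwE[OF bg] that by auto
      then have "g k < d" "\<pi> (g k) < length ds" using iff J by auto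
      then show ?thesis using i[of "g k"] us[OF that] assms by (simp add: branch_Node)
    qed
    ultimately show "tree_iso (Some (Node ?us)) ?D"
      unfolding tree_iso_Node by blast
  qed
qed

section \<open>Induced trees\<close>

lemma suppress_unary_singleton: "suppress_unary (Node [t]) = suppress_unary t"
  by simp

lemma suppress_unary_branching:
  assumes "2 \<le> length ts"
  shows "suppress_unary (Node ts) = Node (map suppress_unary ts)"
  using assms by (auto split: list.splits)

declare prune.simps [simp del] suppress_unary.simps [simp del]

lemma prune_single_branch:
  assumes "i < length ts" "S \<noteq> {}"
  shows "prune (Node ts) (Cons i ` S) = Node [prune (ts ! i) S]"
proof -
  have "filter (\<lambda>j. \<exists>v. j # v \<in> Cons i ` S) [0..<length ts] = filter (\<lambda>j. j = i) [0..<length ts]"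
    using assms by (intro filter_cong) auto
  also have "\<dots> = [i]"
  proof -
    have "i < n \<Longrightarrow> filter (\<lambda>j. j = i) [0..<n] = [i]" for n
      by (induction n) (auto simp: less_Suc_eq filter_empty_conv)
    then show ?thesis using assms(1) by blast
  qed
  finally show ?thesis by (simp add: prune.simps image_iff)
qed

lemma leaf_set_cases:
  assumes "S \<subseteq> {v. is_vertex (Node ts) v}" "S \<noteq> {}"
  obtains (root) "[] \<in> S"
    | (single) i S' where "i < length ts" "S' \<noteq> {}" "S' \<subseteq> {v. is_vertex (ts ! i) v}" "S = Cons i ` S'"
    | (multi) i u j v where "i < length ts" "j < length ts" "i \<noteq> j" "i # u \<in> S" "j # v \<in> S"
proof (cases "[] \<in> S")
  case True
  then show ?thesis by (rule root)
next
  case False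
  obtain x where x: "x \<in> S" using assms by blast
  with False obtain i u where iu: "x = i # u" by (cases x) auto
  have i: "i < length ts" using x iu assms by auto
  show ?thesis
  proof (cases "\<forall>y\<in>S. \<exists>w. y = i # w")
    case True
    then have S: "S = Cons i ` {w. i # w \<in> S}" by force
    show ?thesis
      by (rule single[OF i _ _ S]) (use x iu assms in auto)
  next
    case no: False
    then obtain y where y: "y \<in> S" "\<nexists>w. y = i # w" by blast
    with False obtain j v where jv: "y = j # v" by (cases y) auto
    then have "j \<noteq> i" "j < length ts" using y assms by auto
    then show ?thesis using multi[of i j u v] i x iu y jv by blast
  qed
qed

lemma suppress_spanning_subtree:
  assumes "S \<noteq> {}" "S \<subseteq> {v. is_vertex t v}"
  shows "suppress_unary (spanning_subtree t S) = suppress_unary (prune t S)"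
  using assms
proof (induction t arbitrary: S)
  case (Node ts)
  have *: ?case if "Longest_common_prefix S = []"
    using that by (simp add: spanning_subtree_def)
  from Node.prems(2,1) show ?case
  proof (cases rule: leaf_set_cases)
    case root
    then show ?thesis by (intro * Longest_common_prefix_Nil)
  next
    case (single i S')
    then have "spanning_subtree (Node ts) S = spanning_subtree (ts ! i) S'"
      by (simp add: spanning_subtree_def Let_def Longest_common_prefix_image_Cons image_iff)
    then show ?thesis
      using Node.IH[of "ts ! i" S'] single
      by (simp add: prune_single_branch suppress_unary_singleton)
  next
    case (multi i u j v)
    then show ?thesis by (intro * Longest_common_prefix_eq_Nil)
  qed
qed

lemma induced_tree_eq_prune:
  assumes "S \<subseteq> tree_leaves (Some t)" "S \<noteq> {}"
  shows "induced_tree (Some t) S = Some (suppress_unary (prune t S))"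
proof -
  have "S \<subseteq> {v. is_vertex t v}" using assms by (auto simp: tree_leaves.simps(2))
  then show ?thesis using assms by (simp add: induced_tree_def suppress_spanning_subtree)
qed

lemma induced_tree_empty [simp]: "induced_tree T {} = None"
  by (auto simp: induced_tree_def split: option.splits)

lemma induced_tree_None [simp]: "induced_tree None S = None"
  by (auto simp: induced_tree_def)

lemma induced_tree_single_branch:
  assumes "i < length ts" "S \<subseteq> tree_leaves (Some (ts ! i))" "S \<noteq> {}"
  shows "induced_tree (Some (Node ts)) (Cons i ` S) = induced_tree (Some (ts ! i)) S"
proof -
  have "ts \<noteq> []" using assms by auto
  then have "Cons i ` S \<subseteq> tree_leaves (Some (Node ts))"
    using assms unfolding tree_leaves_Node[OF \<open>ts \<noteq> []\<close>] by auto
  then show ?thesis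
    using assms by (simp add: induced_tree_eq_prune prune_single_branch suppress_unary_singleton)
qed

lemma induced_tree_branching:
  assumes "S \<subseteq> tree_leaves (Some (Node ts))" "length ts \<le> d"
    and "i # u \<in> S" "j # v \<in> S" "i \<noteq> j"
  defines "X \<equiv> \<lambda>l. induced_tree (branch d (Some (Node ts)) l) {w. l # w \<in> S}"
  shows "induced_tree (Some (Node ts)) S =
    Some (Node (map (\<lambda>l. the (X l)) (filter (\<lambda>l. X l \<noteq> None) [0..<d])))"
proof -
  let ?P = "\<lambda>l. \<exists>w. l # w \<in> S"
  have sub: "{w. l # w \<in> S} \<subseteq> tree_leaves (Some (ts ! l))" "l < length ts" if "?P l" for l
  proof -
    have "ts \<noteq> []" using assms(1,3) tree_leaves_Nil by (metis empty_iff insert_iff list.distinct(1) subsetD)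
    then show "{w. l # w \<in> S} \<subseteq> tree_leaves (Some (ts ! l))" "l < length ts"
      using assms(1) that tree_leaves_Node[OF \<open>ts \<noteq> []\<close>] by auto
  qed
  have X1: "X l = Some (suppress_unary (prune (ts ! l) {w. l # w \<in> S}))" if "?P l" for l
    unfolding X_def using sub[OF that] that assms(2)
    by (subst branch_Node) (auto intro: induced_tree_eq_prune)
  have X0: "X l = None" if "\<not> ?P l" for l
    unfolding X_def using that by simp
  have ij: "i < length ts" "j < length ts" using sub assms by blast+
  let ?f = "filter ?P [0..<length ts]"
  have f: "filter (\<lambda>l. X l \<noteq> None) [0..<d] = ?f"
  proof -
    have "[0..<d] = [0..<length ts] @ [length ts..<d]"
      using assms(2) by (metis le0 le_add_diff_inverse upt_add_eq_append)
    moreover have "filter (\<lambda>l. X l \<noteq> None) [length ts..<d] = []"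
      using X0 sub(2) by (force simp: filter_empty_conv)
    moreover have "filter (\<lambda>l. X l \<noteq> None) [0..<length ts] = ?f"
    proof (rule filter_cong)
      show "X l \<noteq> None \<longleftrightarrow> ?P l" for l
        using X0[of l] X1[of l] by (cases "?P l") auto
    qed simp
    ultimately show ?thesis by simp
  qed
  have "card {i, j} \<le> card (set ?f)"
    using assms ij by (intro card_mono) auto
  also have "\<dots> = length ?f" by (rule distinct_card) simp
  finally have l2: "2 \<le> length ?f" using \<open>i \<noteq> j\<close> by simp
  have "induced_tree (Some (Node ts)) S = Some (suppress_unary (prune (Node ts) S))"
    using assms by (intro induced_tree_eq_prune) auto
  also have "suppress_unary (prune (Node ts) S) =
      Node (map (\<lambda>l. suppress_unary (prune (ts ! l) {w. l # w \<in> S})) ?f)"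
    unfolding prune.simps using l2 by (subst suppress_unary_branching) simp_all
  also have "map (\<lambda>l. suppress_unary (prune (ts ! l) {w. l # w \<in> S})) ?f = map (\<lambda>l. the (X l)) ?f"
    using X1 by (intro map_cong) auto
  finally show ?thesis unfolding f .
qed

lemma card_eq_sum_sections:
  fixes S :: "nat list set"
  assumes "finite S" "S \<subseteq> (\<Union>j<d. Cons j ` A j)"
  shows "card S = (\<Sum>j<d. card {v. j # v \<in> S})"
proof -
  have "S = (\<Union>j<d. Cons j ` {v. j # v \<in> S})" using assms(2) by blast
  then have "card S = card (\<Union>j<d. Cons j ` {v. j # v \<in> S})" by (rule arg_cong)
  also have "\<dots> = (\<Sum>j<d. card (Cons j ` {v. j # v \<in> S}))"
  proof (intro card_UN_disjoint ballI finite_imageI)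
    fix j
    have "finite ((\<lambda>v. j # v) -` S)" by (rule finite_vimageI) (use assms in auto)
    then show "finite {v. j # v \<in> S}" by (simp add: vimage_def)
  qed auto
  finally show ?thesis by (simp add: card_image)
qed

lemma num_leaves_induced_tree:
  assumes "S \<subseteq> tree_leaves T"
  shows "num_leaves (induced_tree T S) = card S"
proof (cases T)
  case None
  then show ?thesis using assms by simp
next
  case (Some t)
  have "num_leaves (induced_tree (Some t) S) = card S" if "S \<subseteq> tree_leaves (Some t)"
    using that
  proof (induction t arbitrary: S)
    case (Node ts)
    show ?case
    proof (cases "S = {}")
      case ne: False
      have fin: "finite S" using finite_subset[OF Node.prems finite_tree_leaves] .
      show ?thesis
      proof (cases "ts = []")
        case True
        then have "S = {[]}" using Node.prems ne tree_leaves_Nil by auto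
        moreover have "suppress_unary (prune (Node []) {[]}) = Node []"
          by (simp add: prune.simps suppress_unary.simps)
        ultimately show ?thesis
          using True Node.prems by (simp add: induced_tree_eq_prune)
      next
        case False
        note L = tree_leaves_Node[OF False]
        have "S \<subseteq> {v. is_vertex (Node ts) v}"
          using Node.prems by (auto simp: tree_leaves.simps(2))
        from this ne show ?thesis
        proof (cases rule: leaf_set_cases)
          case root
          then show ?thesis using Node.prems L by auto
        next
          case (single i S')
          then have S': "S' \<subseteq> tree_leaves (Some (ts ! i))" using Node.prems L by auto
          then show ?thesis
            using single Node.IH[of "ts ! i" S'] by (simp add: induced_tree_single_branch card_image)
        next
          case (multi i u j v)
          let ?d = "length ts"
          let ?X = "\<lambda>l. induced_tree (branch ?d (Some (Node ts)) l) {w. l # w \<in> S}"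
          let ?f = "filter (\<lambda>l. ?X l \<noteq> None) [0..<?d]"
          let ?us = "map (\<lambda>l. the (?X l)) ?f"
          have X: "num_leaves (?X l) = card {w. l # w \<in> S}" if "l < ?d" for l
            using Node.IH[of "ts ! l" "{w. l # w \<in> S}"] Node.prems L that by (auto simp: branch_Node)
          have "card {w. i # w \<in> S} \<noteq> 0"
            using multi fin finite_vimageI[OF fin, of "Cons i"] by (auto simp: vimage_def)
          then have "?X i \<noteq> None" 
            using X[OF multi(1)] num_leaves_None by metis
          then have "?us \<noteq> []" using multi by (auto simp: filter_empty_conv)
          have "num_leaves (Some (Node ?us)) = (\<Sum>u\<leftarrow>?us. num_leaves (Some u))"
            using \<open>?us \<noteq> []\<close> by (simp add: num_leaves_Node sum_list_sum_nth atLeast0LessThan)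
          also have "\<dots> = (\<Sum>l\<leftarrow>?f. num_leaves (?X l))"
            unfolding map_map comp_def by (intro arg_cong[of _ _ sum_list] map_cong) auto
          also have "\<dots> = (\<Sum>l\<leftarrow>[0..<?d]. num_leaves (?X l))"
            by (rule sum_list_map_filter) auto
          also have "\<dots> = (\<Sum>l<?d. num_leaves (?X l))"
            by (simp add: interv_sum_list_conv_sum_set_nat atLeast0LessThan)
          also have "\<dots> = (\<Sum>l<?d. card {w. l # w \<in> S})"
            using X by (intro sum.cong) auto
          also have "\<dots> = card S"
            using card_eq_sum_sections[OF fin Node.prems[unfolded L]] by simp
          finally show ?thesis
            using induced_tree_branching[OF Node.prems order.refl multi(4,5,3)] by simp
        qed
      qed
    qed simp
  qed
  then show ?thesis using assms Some by simp
qed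

section \<open>The recurrence for the number of copies\<close>

definition copies :: "dtree \<Rightarrow> dtree \<Rightarrow> nat list set set" where
  "copies D T = {S. S \<subseteq> tree_leaves T \<and> tree_iso (induced_tree T S) D}"

lemma tree_count_eq_card_copies: "tree_count D T = card (copies D T)"
proof -
  have "card S = num_leaves D" if "S \<subseteq> tree_leaves T" "tree_iso (induced_tree T S) D" for S
    using tree_iso_num_leaves[OF that(2)] num_leaves_induced_tree[OF that(1)] by simp
  then have "{S. S \<subseteq> tree_leaves T \<and> card S = num_leaves D \<and> tree_iso (induced_tree T S) D} = copies D T"
    by (auto simp: copies_def)
  then show ?thesis by (simp add: tree_count_def)
qed

lemma finite_copies: "finite (copies D T)"
  by (rule finite_subset[of _ "Pow (tree_leaves T)"]) (auto simp: copies_def finite_tree_leaves)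

lemma tree_count_le_binomial: "tree_count D T \<le> num_leaves T choose num_leaves D"
proof -
  have "tree_count D T \<le> card {S. S \<subseteq> tree_leaves T \<and> card S = num_leaves D}"
    unfolding tree_count_def
  proof (rule card_mono)
    show "finite {S. S \<subseteq> tree_leaves T \<and> card S = num_leaves D}"
      by (rule finite_subset[of _ "Pow (tree_leaves T)"]) (auto simp: finite_tree_leaves)
  qed auto
  then show ?thesis by (simp add: n_subsets finite_tree_leaves num_leaves_def)
qed

lemma copies_None_right: "copies (Some t) None = {}"
  using tree_iso_None_iff by (fastforce simp: copies_def)

lemma empty_in_copies_iff: "{} \<in> copies D T \<longleftrightarrow> D = None"
  using tree_iso_None_iff[of None D] by (auto simp: copies_def tree_iso_refl)

lemma tree_count_None_left [simp]: "tree_count None T = 1"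
proof -
  have "S = {}" if "S \<in> copies None T" for S
  proof -
    have "card S = 0"
      using that num_leaves_induced_tree[of S T] tree_iso_num_leaves by (fastforce simp: copies_def)
    moreover have "finite S"
      using that by (auto simp: copies_def intro: finite_subset[OF _ finite_tree_leaves])
    ultimately show ?thesis by simp
  qed
  then have "copies None T = {{}}" using empty_in_copies_iff[of None T] by blast
  then show ?thesis by (simp add: tree_count_eq_card_copies)
qed

lemma induced_tree_single_leaf:
  assumes "v \<in> tree_leaves T"
  shows "induced_tree T {v} = Some (Node [])"
proof -
  obtain t where T: "T = Some t" using assms by (cases T) auto
  have "Longest_common_prefix {v} = v"
    by (rule Longest_common_prefix_eq) (auto dest: prefix_length_le)
  moreover have "children (subtree_at t v) = []"
    using assms T by (simp add: tree_leaves.simps(2))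
  moreover have "prune u {[]} = Node []" if "children u = []" for u
    using that by (cases u) (simp add: prune.simps)
  ultimately show ?thesis
    by (simp add: T induced_tree_def spanning_subtree_def suppress_unary.simps)
qed

lemma tree_count_leaf: "tree_count (Some (Node [])) T = num_leaves T"
proof -
  have "S \<in> copies (Some (Node [])) T \<longleftrightarrow> S \<in> (\<lambda>v. {v}) ` tree_leaves T" for S
  proof
    assume "S \<in> copies (Some (Node [])) T"
    then have S: "S \<subseteq> tree_leaves T" "tree_iso (induced_tree T S) (Some (Node []))"
      by (auto simp: copies_def)
    then have "card S = 1"
      using tree_iso_num_leaves[OF S(2)] num_leaves_induced_tree[OF S(1)] by simp
    then show "S \<in> (\<lambda>v. {v}) ` tree_leaves T" using S(1) by (auto simp: card_1_singleton_iff)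
  qed (auto simp: copies_def induced_tree_single_leaf tree_iso_refl)
  then have "copies (Some (Node [])) T = (\<lambda>v. {v}) ` tree_leaves T" by blast
  then show ?thesis by (simp add: tree_count_eq_card_copies card_image num_leaves_def)
qed

lemma finite_representatives:
  assumes "complete_representatives d D M" shows "finite M"
  by (rule finite_subset[OF _ finite_permutations[of "{..<d}"]])
    (use assms in \<open>auto simp: complete_representatives_def\<close>)

lemma branch_equiv_refl: "branch_equiv d D \<pi> \<pi>"
  by (simp add: branch_equiv_def tree_iso_refl)

lemma branch_equiv_sym: "branch_equiv d D \<pi> \<rho> \<Longrightarrow> branch_equiv d D \<rho> \<pi>"
  by (auto simp: branch_equiv_def intro: tree_iso_sym)

lemma branch_equiv_trans:
  "branch_equiv d D \<pi> \<rho> \<Longrightarrow> branch_equiv d D \<rho> \<sigma> \<Longrightarrow> branch_equiv d D \<pi> \<sigma>"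
  by (auto simp: branch_equiv_def intro: tree_iso_trans)

lemma complete_representatives_exist: "\<exists>M. complete_representatives d D M"
proof -
  let ?P = "{\<pi>. \<pi> permutes {..<d}}"
  define f where "f \<pi> = (SOME \<rho>. \<rho> \<in> ?P \<and> branch_equiv d D \<pi> \<rho>)" for \<pi>
  have f: "f \<pi> \<in> ?P \<and> branch_equiv d D \<pi> (f \<pi>)" if "\<pi> \<in> ?P" for \<pi>
    unfolding f_def by (rule someI[of _ \<pi>]) (use that in \<open>auto simp: branch_equiv_refl\<close>)
  have f_eq: "f \<pi> = f \<rho>" if "branch_equiv d D \<pi> \<rho>" for \<pi> \<rho>
  proof -
    have "branch_equiv d D \<pi> \<sigma> \<longleftrightarrow> branch_equiv d D \<rho> \<sigma>" for \<sigma>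
      using that branch_equiv_sym branch_equiv_trans by blast
    then show ?thesis by (simp add: f_def)
  qed
  have "complete_representatives d D (f ` ?P)"
    unfolding complete_representatives_def
  proof (intro conjI allI impI)
    show "f ` ?P \<subseteq> ?P" using f by blast
    fix \<pi> assume p: "\<pi> permutes {..<d}"
    show "\<exists>!\<rho>. \<rho> \<in> f ` ?P \<and> branch_equiv d D \<pi> \<rho>"
    proof (rule ex1I[of _ "f \<pi>"])
      fix \<rho> assume r: "\<rho> \<in> f ` ?P \<and> branch_equiv d D \<pi> \<rho>"
      then obtain \<sigma> where s: "\<sigma> \<in> ?P" "\<rho> = f \<sigma>" by blast
      then have "branch_equiv d D \<pi> \<sigma>"
        using f[OF s(1)] r branch_equiv_sym branch_equiv_trans by metis
      then show "\<rho> = f \<pi>" using f_eq s by simp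
    qed (use f p in blast)
  qed
  then show ?thesis by blast
qed

definition glue :: "nat \<Rightarrow> (nat \<Rightarrow> nat list set) \<Rightarrow> nat list set" where
  "glue d g = (\<Union>j<d. Cons j ` g j)"

lemma section_glue: "j < d \<Longrightarrow> {v. j # v \<in> glue d g} = g j"
  by (auto simp: glue_def)

lemma glue_sections:
  assumes "S \<subseteq> (\<Union>j<d. Cons j ` A j)"
  shows "glue d (\<lambda>j\<in>{..<d}. {v. j # v \<in> S}) = S"
  using assms unfolding glue_def by fastforce

lemma glue_inj:
  assumes "g \<in> extensional {..<d}" "h \<in> extensional {..<d}" "glue d g = glue d h"
  shows "g = h"
  using assms(1,2)
proof (rule extensionalityI)
  fix j assume "j \<in> {..<d}"
  then show "g j = h j" using section_glue[of j d g] section_glue[of j d h] assms(3) by simp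
qed

lemma copies_Node:
  assumes "ts \<noteq> []" "length ts \<le> d" "2 \<le> length ds" "length ds \<le> d"
    and M: "complete_representatives d (Some (Node ds)) M"
  defines "T \<equiv> Some (Node ts)" and "D \<equiv> Some (Node ds)"
  shows "copies D T = (\<Union>j<d. (`) (Cons j) ` copies D (branch d T j)) \<union>
    (\<Union>\<pi>\<in>M. glue d ` (\<Pi>\<^sub>E j\<in>{..<d}. copies (branch d D (\<pi> j)) (branch d T j)))"
    (is "_ = ?A \<union> ?B")
    and glue_two_branches: "\<And>\<pi> g. \<pi> permutes {..<d} \<Longrightarrow>
      g \<in> (\<Pi>\<^sub>E j\<in>{..<d}. copies (branch d D (\<pi> j)) (branch d T j)) \<Longrightarrow>
      \<exists>i j. i < d \<and> j < d \<and> i \<noteq> j \<and> g i \<noteq> {} \<and> g j \<noteq> {}"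
proof -
  note L = tree_leaves_branch[OF assms(1,2), folded T_def]
  have Mp: "\<pi> permutes {..<d}" if "\<pi> \<in> M" for \<pi>
    using that M by (auto simp: complete_representatives_def)
  show two: "\<exists>i j. i < d \<and> j < d \<and> i \<noteq> j \<and> g i \<noteq> {} \<and> g j \<noteq> {}"
    if p: "\<pi> permutes {..<d}" and g: "g \<in> (\<Pi>\<^sub>E j\<in>{..<d}. copies (branch d D (\<pi> j)) (branch d T j))"
    for \<pi> g
  proof -
    have ne: "g (inv \<pi> k) \<noteq> {} \<and> inv \<pi> k < d" if "k < 2" for k
    proof -
      have k: "k < length ds" "k < d" using that assms by auto
      have i: "inv \<pi> k < d" using permutes_in_image[OF permutes_inv[OF p], of k] k by simp
      have "branch d D (\<pi> (inv \<pi> k)) \<noteq> None"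
        using k assms permutes_inverses(1)[OF p] by (simp add: D_def branch_Node)
      moreover have "g (inv \<pi> k) \<in> copies (branch d D (\<pi> (inv \<pi> k))) (branch d T (inv \<pi> k))"
        using PiE_mem[OF g] i by simp
      ultimately show ?thesis using i empty_in_copies_iff by metis
    qed
    moreover have "inv \<pi> 0 \<noteq> inv \<pi> 1"
      by (metis permutes_inverses(1)[OF p] zero_neq_one)
    ultimately show ?thesis 
      using ne[of 0] ne[of 1] by (intro exI[of _ "inv \<pi> 0"] exI[of _ "inv \<pi> 1"]) simp
  qed
  show "copies D T = ?A \<union> ?B"
  proof (intro equalityI subsetI)
    fix S assume "S \<in> copies D T"
    then have S: "S \<subseteq> tree_leaves T" and iso: "tree_iso (induced_tree T S) D"
      by (auto simp: copies_def)
    have ne: "S \<noteq> {}" using \<open>S \<in> copies D T\<close> empty_in_copies_iff[of D T] by (auto simp: D_def)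
    have "S \<subseteq> {v. is_vertex (Node ts) v}"
      using S by (auto simp: T_def tree_leaves.simps(2))
    from this ne show "S \<in> ?A \<union> ?B"
    proof (cases rule: leaf_set_cases)
      case root
      then show ?thesis using S L by auto
    next
      case (single i S')
      then have "i < d" using assms by simp
      have b: "branch d T i = Some (ts ! i)"
        using single \<open>i < d\<close> assms by (simp add: T_def branch_Node)
      have "S' \<subseteq> tree_leaves (Some (ts ! i))"
        using S single tree_leaves_Node[OF assms(1)] by (auto simp: T_def)
      moreover from this have "tree_iso (induced_tree (Some (ts ! i)) S') D"
        using iso single by (simp add: T_def induced_tree_single_branch)
      ultimately have "S' \<in> copies D (branch d T i)" using b by (simp add: copies_def)
      then have "S \<in> (`) (Cons i) ` copies D (branch d T i)" using single by (intro image_eqI)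
      then show ?thesis using \<open>i < d\<close> by blast
    next
      case (multi i u j v)
      let ?X = "\<lambda>l. induced_tree (branch d T l) {w. l # w \<in> S}"
      obtain \<pi> where p: "\<pi> permutes {..<d}" and X: "\<And>l. l < d \<Longrightarrow> tree_iso (?X l) (branch d D (\<pi> l))"
        using iso tree_iso_Node_branch[OF assms(4), of ?X]
          induced_tree_branching[OF S[unfolded T_def] assms(2) multi(4,5,3)]
        unfolding T_def D_def by auto
      obtain \<rho> where r: "\<rho> \<in> M" "branch_equiv d D \<pi> \<rho>"
        using M p unfolding complete_representatives_def D_def by blast
      have "{w. l # w \<in> S} \<in> copies (branch d D (\<rho> l)) (branch d T l)" if "l < d" for l
        using r(2) X[OF that] that S L by (auto simp: copies_def branch_equiv_def intro: tree_iso_trans)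
      then have "(\<lambda>j\<in>{..<d}. {v. j # v \<in> S}) \<in> (\<Pi>\<^sub>E j\<in>{..<d}. copies (branch d D (\<rho> j)) (branch d T j))"
        by auto
      moreover have "S = glue d (\<lambda>j\<in>{..<d}. {v. j # v \<in> S})"
        using glue_sections[OF S[unfolded L]] by (rule sym)
      ultimately show ?thesis using r(1) by blast
    qed
  next
    fix S assume "S \<in> ?A \<union> ?B"
    then show "S \<in> copies D T"
    proof
      assume "S \<in> ?A"
      then obtain j S' where j: "j < d" "S = Cons j ` S'" and S': "S' \<in> copies D (branch d T j)" by blast
      have "branch d T j \<noteq> None" using S' copies_None_right unfolding D_def by (metis empty_iff)
      then have jl: "j < length ts" "branch d T j = Some (ts ! j)"
        using j assms(2) by (auto simp: T_def branch_Node split: if_splits)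
      have "S' \<noteq> {}" using S' empty_in_copies_iff[of D] by (auto simp: D_def)
      moreover have "S' \<subseteq> tree_leaves (Some (ts ! j))" "tree_iso (induced_tree (Some (ts ! j)) S') D"
        using S' jl by (auto simp: copies_def)
      moreover from this have "S \<subseteq> tree_leaves T"
        using j jl tree_leaves_Node[OF assms(1)] unfolding T_def by blast
      ultimately show ?thesis
        using j jl by (simp add: copies_def T_def induced_tree_single_branch)
    next
      assume "S \<in> ?B"
      then obtain \<pi> g where p: "\<pi> \<in> M" and S: "S = glue d g"
        and g: "g \<in> (\<Pi>\<^sub>E j\<in>{..<d}. copies (branch d D (\<pi> j)) (branch d T j))" by blast
      obtain i j where "i < d" "j < d" and ij: "i \<noteq> j" and "g i \<noteq> {}" "g j \<noteq> {}"
        using two[OF Mp[OF p] g] by blast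
      then obtain u v where uv: "i # u \<in> S" "j # v \<in> S" by (auto simp: S glue_def)
      have gj: "g l \<in> copies (branch d D (\<pi> l)) (branch d T l)" if "l < d" for l
        using PiE_mem[OF g] that by simp
      have Sub: "S \<subseteq> tree_leaves T"
        using gj unfolding L S glue_def by (fastforce simp: copies_def)
      have "tree_iso (induced_tree (branch d T l) {w. l # w \<in> S}) (branch d D (\<pi> l))" if "l < d" for l
        using gj[OF that] section_glue[OF that, of g] by (simp add: S copies_def)
      then have "tree_iso (induced_tree T S) D"
        using tree_iso_Node_branch[OF assms(4), of "\<lambda>l. induced_tree (branch d T l) {w. l # w \<in> S}"]
          induced_tree_branching[OF Sub[unfolded T_def] assms(2) uv ij] Mp[OF p]
        unfolding T_def D_def by auto
      then show ?thesis using Sub by (simp add: copies_def)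
    qed
  qed
qed

theorem tree_count_Node:
  assumes "ts \<noteq> []" "length ts \<le> d" "2 \<le> length ds" "length ds \<le> d"
    and M: "complete_representatives d (Some (Node ds)) M"
  defines "T \<equiv> Some (Node ts)" and "D \<equiv> Some (Node ds)"
  shows "tree_count D T = (\<Sum>j<d. tree_count D (branch d T j)) +
    (\<Sum>\<pi>\<in>M. \<Prod>j<d. tree_count (branch d D (\<pi> j)) (branch d T j))"
proof -
  let ?A = "\<lambda>j. (`) (Cons j) ` copies D (branch d T j)"
  let ?P = "\<lambda>\<pi>. \<Pi>\<^sub>E j\<in>{..<d}. copies (branch d D (\<pi> j)) (branch d T j)"
  let ?B = "\<lambda>\<pi>. glue d ` ?P \<pi>"
  have finM: "finite M" using M by (rule finite_representatives)
  have Mp: "\<pi> permutes {..<d}" if "\<pi> \<in> M" for \<pi>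
    using that M by (auto simp: complete_representatives_def)
  have finA: "finite (?A j)" for j by (simp add: finite_copies)
  have finB: "finite (?B \<pi>)" for \<pi> by (simp add: finite_copies finite_PiE)
  have neA: "S \<noteq> {}" if "S \<in> ?A j" for S j
    using that empty_in_copies_iff[of D "branch d T j"] by (auto simp: D_def)
  have cA: "card (?A j) = tree_count D (branch d T j)" for j
  proof -
    have "inj_on ((`) (Cons j)) X" for X :: "nat list set set"
      by (intro inj_on_subset[OF inj_on_image_Pow[of _ UNIV]]) auto
    then show ?thesis by (simp add: card_image tree_count_eq_card_copies)
  qed
  have cB: "card (?B \<pi>) = (\<Prod>j<d. tree_count (branch d D (\<pi> j)) (branch d T j))" for \<pi>
  proof -
    have "inj_on (glue d) (?P \<pi>)"
      by (rule inj_onI, rule glue_inj) (auto simp: PiE_def)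
    then show ?thesis by (simp add: card_image card_PiE tree_count_eq_card_copies)
  qed
  have "?A i \<inter> ?A j = {}" if "i \<noteq> j" for i j
  proof -
    have False if "S \<in> ?A i" "S \<in> ?A j" for S
      using neA[OF that(1)] that \<open>i \<noteq> j\<close> by auto
    then show ?thesis by blast
  qed
  then have dA: "card (\<Union>j<d. ?A j) = (\<Sum>j<d. card (?A j))"
    using finA by (intro card_UN_disjoint) auto
  have "?B \<pi> \<inter> ?B \<rho> = {}" if "\<pi> \<in> M" "\<rho> \<in> M" "\<pi> \<noteq> \<rho>" for \<pi> \<rho>
  proof -
    have False if S: "S \<in> ?B \<pi>" "S \<in> ?B \<rho>" for S
    proof -
      obtain g h where g: "g \<in> ?P \<pi>" "S = glue d g" and h: "h \<in> ?P \<rho>" "S = glue d h"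
        using S by blast
      have "g = h"
        by (rule glue_inj[of _ d]) (use g h in \<open>auto simp: PiE_def\<close>)
      then have "g j \<in> copies (branch d D (\<pi> j)) (branch d T j) \<inter> copies (branch d D (\<rho> j)) (branch d T j)"
        if "j < d" for j
        using PiE_mem[OF g(1), of j] PiE_mem[OF h(1), of j] that by simp
      then have "branch_equiv d D \<pi> \<rho>"
        unfolding branch_equiv_def copies_def using tree_iso_sym tree_iso_trans by blast
      then show False
        using M Mp \<open>\<pi> \<in> M\<close> \<open>\<rho> \<in> M\<close> \<open>\<pi> \<noteq> \<rho>\<close> branch_equiv_refl
        unfolding complete_representatives_def D_def by metis
    qed
    then show ?thesis by blast
  qed
  then have dB: "card (\<Union>\<pi>\<in>M. ?B \<pi>) = (\<Sum>\<pi>\<in>M. card (?B \<pi>))"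
    using finB finM by (intro card_UN_disjoint) auto
  have "(\<Union>j<d. ?A j) \<inter> (\<Union>\<pi>\<in>M. ?B \<pi>) = {}"
  proof -
    have False if S: "S \<in> ?A l" "\<pi> \<in> M" "S \<in> ?B \<pi>" for S l \<pi>
    proof -
      obtain g where g: "g \<in> ?P \<pi>" "S = glue d g" using S by blast
      obtain i j where "i < d" "j < d" "i \<noteq> j" "g i \<noteq> {}" "g j \<noteq> {}"
        using glue_two_branches[OF assms(1-5) Mp[OF S(2)] g(1)[unfolded T_def D_def]] by blast
      then obtain u v where "i # u \<in> S" "j # v \<in> S" by (auto simp: g glue_def)
      then show False using S(1) \<open>i \<noteq> j\<close> by auto
    qed
    then show ?thesis by blast
  qed
  then have "card ((\<Union>j<d. ?A j) \<union> (\<Union>\<pi>\<in>M. ?B \<pi>)) = card (\<Union>j<d. ?A j) + card (\<Union>\<pi>\<in>M. ?B \<pi>)"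
    using finA finB finM by (intro card_Un_disjoint) auto
  then show ?thesis
    unfolding tree_count_eq_card_copies[of D T] copies_Node(1)[OF assms(1-5), folded T_def D_def]
    by (simp only: dA dB cA cB)
qed

lemma dary_branch:
  assumes "dary d (Some (Node ts))" "i < d"
  shows "dary d (branch d (Some (Node ts)) i)"
proof -
  have "length ts \<le> d" using assms(1) unfolding dary_Node by (cases "ts = []") auto
  then show ?thesis
    using assms by (auto simp: branch_Node dary_Node)
qed

lemma num_leaves_ge_2:
  assumes "2 \<le> length ts"
  shows "2 \<le> num_leaves (Some (Node ts))"
proof -
  have "2 \<le> (\<Sum>i<length ts. 1 :: nat)" using assms by simp
  also have "\<dots> \<le> (\<Sum>i<length ts. num_leaves (Some (ts ! i)))"
    by (intro sum_mono num_leaves_pos)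
  finally show ?thesis using assms num_leaves_Node[of ts] by fastforce
qed

section \<open>Grafting\<close>

fun graft :: "rtree \<Rightarrow> rtree \<Rightarrow> rtree" where
  "graft b (Node ts) = (if ts = [] then b else Node (map (graft b) ts))"

lemma num_leaves_graft:
  "num_leaves (Some (graft b t)) = num_leaves (Some t) * num_leaves (Some b)"
proof (induction t)
  case (Node ts)
  then show ?case
    by (cases "ts = []") (simp_all add: num_leaves_Node sum_distrib_right)
qed

lemma dary_graft:
  assumes "dary d (Some b)" "dary d (Some t)"
  shows "dary d (Some (graft b t))"
  using assms(2)
proof (induction t)
  case (Node ts)
  then show ?case
    using assms(1) by (cases "ts = []") (auto simp: dary_Node)
qed

lemma tree_count_graft:
  assumes "dary d D" "dary d (Some t)"
  shows "tree_count D (Some t) * num_leaves (Some b) ^ num_leaves D \<le> tree_count D (Some (graft b t))"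
  using assms
proof (induction t arbitrary: D)
  case (Node ts)
  let ?k = "num_leaves (Some b)" and ?T = "Some (Node ts)"
  show ?case
  proof (cases D)
    case (Some t')
    obtain ds where "t' = Node ds" by (cases t')
    with Some have D: "D = Some (Node ds)" by simp
    show ?thesis
    proof (cases "ds = []")
      case True
      then show ?thesis by (simp add: D tree_count_leaf num_leaves_graft del: graft.simps)
    next
      case ds: False
      have lds: "2 \<le> length ds" "length ds \<le> d"
        using Node.prems(1) ds unfolding D dary_Node by auto
      show ?thesis
      proof (cases "ts = []")
        case True
        have "tree_count D ?T \<le> 1 choose num_leaves D"
          using tree_count_le_binomial[of D ?T] True by simp
        then have "tree_count D ?T = 0"
          using num_leaves_ge_2[OF lds(1)] by (simp add: D binomial_eq_0)
        then show ?thesis by simp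
      next
        case ts: False
        have lts: "length ts \<le> d"
          using Node.prems(2) ts unfolding dary_Node by auto
        let ?us = "map (graft b) ts"
        obtain M where M: "complete_representatives d D M"
          using complete_representatives_exist by blast
        have IH: "tree_count E (branch d ?T j) * ?k ^ num_leaves E \<le> tree_count E (branch d (Some (Node ?us)) j)"
          if "j < d" "dary d E" for j E
        proof (cases "j < length ts")
          case True
          then have "dary d (Some (ts ! j))" using Node.prems(2) unfolding dary_Node by auto
          then show ?thesis
            using Node.IH[of "ts ! j" E] True that lts by (simp add: branch_Node)
        next
          case False
          then have b: "branch d ?T j = None" "branch d (Some (Node ?us)) j = None"
            using that lts by (simp_all add: branch_Node)
          show ?thesis
          proof (cases E)
            case (Some e)
            then show ?thesis unfolding b by (simp add: tree_count_eq_card_copies copies_None_right)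
          qed simp
        qed
        have prod: "(\<Prod>j<d. tree_count (branch d D (\<pi> j)) (branch d ?T j)) * ?k ^ num_leaves D
            \<le> (\<Prod>j<d. tree_count (branch d D (\<pi> j)) (branch d (Some (Node ?us)) j))"
          if "\<pi> \<in> M" for \<pi>
        proof -
          have p: "\<pi> permutes {..<d}" using M that by (auto simp: complete_representatives_def)
          have "num_leaves D = (\<Sum>j<d. num_leaves (branch d D (\<pi> j)))"
            using sum.permute[OF p, of "\<lambda>j. num_leaves (branch d D j)"] num_leaves_branch[OF ds lds(2)]
            by (simp add: D comp_def)
          then have "(\<Prod>j<d. tree_count (branch d D (\<pi> j)) (branch d ?T j)) * ?k ^ num_leaves D =
              (\<Prod>j<d. tree_count (branch d D (\<pi> j)) (branch d ?T j) * ?k ^ num_leaves (branch d D (\<pi> j)))"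
            by (simp add: power_sum prod.distrib)
          also have "\<dots> \<le> (\<Prod>j<d. tree_count (branch d D (\<pi> j)) (branch d (Some (Node ?us)) j))"
          proof (intro prod_mono conjI IH)
            fix j assume "j \<in> {..<d}"
            then show "j < d" by simp
            then have "\<pi> j < d" using permutes_in_image[OF p, of j] by simp
            then show "dary d (branch d D (\<pi> j))"
              using Node.prems(1) dary_branch unfolding D by blast
          qed simp
          finally show ?thesis .
        qed
        have "tree_count D ?T * ?k ^ num_leaves D =
            (\<Sum>j<d. tree_count D (branch d ?T j) * ?k ^ num_leaves D) +
            (\<Sum>\<pi>\<in>M. (\<Prod>j<d. tree_count (branch d D (\<pi> j)) (branch d ?T j)) * ?k ^ num_leaves D)"
          using tree_count_Node[OF ts lts lds M[unfolded D]]
          by (simp add: D sum_distrib_right add_mult_distrib)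
        also have "\<dots> \<le> (\<Sum>j<d. tree_count D (branch d (Some (Node ?us)) j)) +
            (\<Sum>\<pi>\<in>M. \<Prod>j<d. tree_count (branch d D (\<pi> j)) (branch d (Some (Node ?us)) j))"
          using IH prod Node.prems(1) by (intro add_mono sum_mono) auto
        also have "\<dots> = tree_count D (Some (Node ?us))"
          using tree_count_Node[of ?us d ds M] ts lts lds M by (simp add: D)
        finally show ?thesis using ts by simp
      qed
    qed
  qed simp
qed

lemma dary_exists:
  assumes "2 \<le> d"
  shows "\<exists>b. dary d (Some b) \<and> num_leaves (Some b) = Suc k"
proof (induction k)
  case 0
  show ?case by (intro exI[of _ "Node []"]) (simp add: dary_Node)
next
  case (Suc k)
  then obtain b where "dary d (Some b)" "num_leaves (Some b) = Suc k" by blast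
  then show ?case
    using assms
    by (intro exI[of _ "Node [Node [], b]"])
      (auto simp: dary_Node num_leaves_Node numeral_2_eq_2 less_Suc_eq)
qed

section \<open>Bounds by the inducibility\<close>

lemma tree_density_bounds: "0 \<le> tree_density D T" "tree_density D T \<le> 1"
  using tree_count_le_binomial[of D T] by (auto simp: tree_density_def divide_le_eq_1)

lemma finite_densities: "finite (tree_density D ` {T. dary d T \<and> num_leaves T = n})"
proof (rule finite_subset)
  show "tree_density D ` {T. dary d T \<and> num_leaves T = n} \<subseteq>
      (\<lambda>c. real c / real (n choose num_leaves D)) ` {..n choose num_leaves D}"
    using tree_count_le_binomial[of D] by (auto simp: tree_density_def)
qed simp

definition max_density :: "nat \<Rightarrow> dtree \<Rightarrow> nat \<Rightarrow> real" where
  "max_density d D n = (MAX T \<in> {T. dary d T \<and> num_leaves T = n}. tree_density D T)"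

lemma max_density_upper:
  "dary d T \<Longrightarrow> tree_density D T \<le> max_density d D (num_leaves T)"
  unfolding max_density_def by (rule Max_ge[OF finite_densities]) auto

lemma max_density_least:
  assumes "2 \<le> d" "\<And>T. dary d T \<Longrightarrow> num_leaves T = n \<Longrightarrow> tree_density D T \<le> c"
  shows "max_density d D n \<le> c"
proof -
  have "\<exists>T. dary d T \<and> num_leaves T = n"
  proof (cases n)
    case (Suc k)
    then show ?thesis using dary_exists[OF assms(1), of k] by auto
  qed (auto intro: exI[of _ None])
  then show ?thesis
    unfolding max_density_def using assms(2) by (subst Max_le_iff[OF finite_densities]) auto
qed

lemma inducibility_Some:
  "inducibility d (Some t) = real_of_ereal (limsup (\<lambda>n. ereal (max_density d (Some t) n)))"
  by (simp add: max_density_def inducibility.simps(2))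

lemma limsup_max_density_le_1:
  assumes "2 \<le> d"
  shows "limsup (\<lambda>n. ereal (max_density d D n)) \<le> 1"
proof (rule Limsup_bounded, rule always_eventually, rule allI)
  show "ereal (max_density d D n) \<le> 1" for n
    using max_density_least[OF assms, of n D 1] tree_density_bounds(2) by simp
qed

lemma tree_count_le_inducibility:
  assumes d: "2 \<le> d" and D: "dary d D" and T: "dary d T"
  shows "real (tree_count D T) \<le>
    inducibility d D * real (num_leaves T) ^ num_leaves D / fact (num_leaves D)"
proof (cases D)
  case (Some s)
  let ?m = "num_leaves D" and ?n = "num_leaves T"
  have m: "1 \<le> ?m" using Some num_leaves_pos by simp
  show ?thesis
  proof (cases T)
    case None
    then show ?thesis
      using m Some by (simp add: tree_count_eq_card_copies copies_None_right power_0_left)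
  next
    case T': (Some t)
    have n: "1 \<le> ?n" using T' num_leaves_pos by simp
    define q where "q = real (tree_count D T) * fact ?m / real ?n ^ ?m"
    let ?X = "\<lambda>n. ereal (max_density d D n)"
    define r where "r k = ?n * (k + ?m)" for k
    have q: "q \<le> max_density d D (r k)" for k
    proof -
      let ?k = "k + ?m"
      obtain b where b: "dary d (Some b)" "num_leaves (Some b) = ?k"
        using dary_exists[OF d, of "?k - 1"] m by auto
      let ?G = "Some (graft b t)"
      have G: "num_leaves ?G = r k" by (simp add: num_leaves_graft b T' r_def)
      have "?k \<le> r k" using n by (simp add: r_def)
      then have pos: "0 < r k choose ?m" by simp
      have "real ((r k choose ?m) * fact ?m) \<le> real (r k ^ ?m)"
        by (subst of_nat_le_iff) (rule binomial_fact_pow)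
      then have "real (r k choose ?m) * fact ?m \<le> real (r k) ^ ?m" by simp
      then have B: "real (r k choose ?m) * fact ?m \<le> real ?n ^ ?m * real ?k ^ ?m"
        by (simp add: r_def power_mult_distrib)
      have "real (tree_count D T * ?k ^ ?m) \<le> real (tree_count D ?G)"
        using tree_count_graft[of d D t b] D T T' b by (simp only: of_nat_le_iff)
      then have C: "real (tree_count D T) * real ?k ^ ?m \<le> real (tree_count D ?G)" by simp
      have "real (tree_count D T) * (real (r k choose ?m) * fact ?m) \<le>
          real (tree_count D T) * (real ?n ^ ?m * real ?k ^ ?m)"
        by (rule mult_left_mono[OF B]) simp
      also have "\<dots> \<le> real (tree_count D ?G) * real ?n ^ ?m"
        using mult_left_mono[OF C, of "real ?n ^ ?m"] by (simp add: mult_ac)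
      finally have "q \<le> tree_density D ?G"
        using pos n by (simp add: q_def tree_density_def G field_simps)
      also have "\<dots> \<le> max_density d D (r k)"
        using max_density_upper[of d ?G D] dary_graft[of d b t] b T T' G by simp
      finally show ?thesis .
    qed
    have "strict_mono r" using n by (simp add: strict_mono_def r_def)
    then have "limsup (?X \<circ> r) \<le> limsup ?X" by (rule limsup_subseq_mono)
    moreover have "ereal q \<le> limsup (?X \<circ> r)"
    proof -
      have "limsup (\<lambda>_::nat. ereal q) \<le> limsup (?X \<circ> r)"
        using q by (intro Limsup_mono) simp
      then show ?thesis by (simp add: Limsup_const)
    qed
    ultimately have L: "ereal q \<le> limsup ?X" by (rule order_trans[rotated])
    have "q \<le> inducibility d D"
      unfolding Some inducibility_Some
      using L[unfolded Some] limsup_max_density_le_1[OF d, of "Some s"]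
      by (cases "limsup (\<lambda>n. ereal (max_density d (Some s) n))") auto
    then show ?thesis using n by (simp add: q_def field_simps)
  qed
qed simp

lemma inducibility_nonneg:
  assumes "2 \<le> d" "dary d D"
  shows "0 \<le> inducibility d D"
proof -
  have "dary d (Some (Node []))" by (simp add: dary_Node)
  from tree_count_le_inducibility[OF assms this]
  have "0 \<le> inducibility d D / fact (num_leaves D)"
    by (simp add: order_trans[OF of_nat_0_le_iff])
  then show ?thesis
    using fact_gt_zero[of "num_leaves D", where 'a = real]
    by (simp add: zero_le_divide_iff not_le[symmetric] del: fact_gt_zero)
qed

lemma inducibility_upper:
  assumes d: "2 \<le> d" and B: "0 \<le> B" and D: "D \<noteq> None"
    and le: "\<And>T. dary d T \<Longrightarrow>
      real (tree_count D T) \<le> B * real (num_leaves T) ^ num_leaves D / fact (num_leaves D)"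
  shows "inducibility d D \<le> B"
proof -
  obtain s where s: "D = Some s" using D by auto
  let ?m = "num_leaves D"
  let ?u = "\<lambda>n. B * (real n / (real n - real ?m)) ^ ?m"
  have "max_density d D n \<le> ?u n" if n: "?m < n" for n
  proof (rule max_density_least[OF d])
    fix T assume T: "dary d T" "num_leaves T = n"
    have "(real n - real ?m) ^ ?m = (\<Prod>i<?m. real n - real ?m)" by simp
    also have "\<dots> \<le> (\<Prod>i<?m. real n - real i)"
      using n by (intro prod_mono) auto
    also have "\<dots> = real (n choose ?m) * fact ?m"
      by (simp add: binomial_gbinomial gbinomial_prod_rev atLeast0LessThan)
    finally have P: "(real n - real ?m) ^ ?m \<le> real (n choose ?m) * fact ?m" .
    have pos: "0 < real n - real ?m" using n by simp
    have pc: "0 < real (n choose ?m)" using n by simp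
    have "tree_density D T \<le> B * real n ^ ?m / (real (n choose ?m) * fact ?m)"
      using le[OF T(1)] pc by (simp add: tree_density_def T field_simps)
    also have "\<dots> \<le> B * real n ^ ?m / (real n - real ?m) ^ ?m"
      using P pos B by (intro divide_left_mono mult_nonneg_nonneg mult_pos_pos) (auto simp: pc)
    finally show "tree_density D T \<le> ?u n" by (simp add: power_divide)
  qed
  then have "limsup (\<lambda>n. ereal (max_density d D n)) \<le> limsup (\<lambda>n. ereal (?u n))"
    by (intro Limsup_mono eventually_mono[OF eventually_gt_at_top[of ?m]]) simp
  also have "\<dots> = ereal B"
  proof (rule lim_imp_Limsup)
    have "(\<lambda>n. real n / (real n - real ?m)) \<longlonglongrightarrow> 1" by real_asymp
    then have "?u \<longlonglongrightarrow> B * 1 ^ ?m" by (intro tendsto_mult tendsto_power tendsto_const)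
    then show "(\<lambda>n. ereal (?u n)) \<longlonglongrightarrow> ereal B" by simp
  qed simp
  finally show ?thesis
    unfolding s inducibility_Some using B
    by (cases "limsup (\<lambda>n. ereal (max_density d (Some s) n))") auto
qed

section \<open>The supremum of the function Z\<close>

lemma sum_power_gap:
  fixes x :: "nat \<Rightarrow> real"
  assumes x: "\<And>i. i < d \<Longrightarrow> 0 \<le> x i \<and> x i < 1" and s: "(\<Sum>i<d. x i) = 1" and m: "2 \<le> m"
  shows "(\<Sum>i<d. x i * (1 - x i)) \<le> 1 - (\<Sum>i<d. x i ^ m)"
    and "0 < 1 - (\<Sum>i<d. x i ^ m)"
proof -
  have "(\<Sum>i<d. x i ^ m) \<le> (\<Sum>i<d. x i ^ 2)"
    using x m by (intro sum_mono power_decreasing) (auto intro: less_imp_le)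
  also have "\<dots> = (\<Sum>i<d. x i) - (\<Sum>i<d. x i * (1 - x i))"
    by (simp add: algebra_simps power2_eq_square sum_subtractf)
  finally show *: "(\<Sum>i<d. x i * (1 - x i)) \<le> 1 - (\<Sum>i<d. x i ^ m)" using s by simp
  obtain k where k: "k < d" "x k \<noteq> 0"
    using s sum.neutral[of "{..<d}" x] by (metis lessThan_iff zero_neq_one)
  have "0 < x k * (1 - x k)" using x[OF k(1)] k(2) by simp
  also have "\<dots> \<le> (\<Sum>i<d. x i * (1 - x i))"
    using x k by (intro member_le_sum) (auto intro: mult_nonneg_nonneg simp: less_imp_le)
  finally show "0 < 1 - (\<Sum>i<d. x i ^ m)" using * by simp
qed

definition open_simplex :: "nat \<Rightarrow> (nat \<Rightarrow> real) set" where
  "open_simplex d = {x. (\<forall>i<d. 0 \<le> x i \<and> x i < 1) \<and> (\<Sum>i<d. x i) = 1}"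

lemma Z_fun_nonneg:
  assumes "x \<in> open_simplex d" "2 \<le> num_leaves D"
  shows "0 \<le> Z_fun d D M x"
proof -
  have "0 < 1 - (\<Sum>i<d. x i ^ num_leaves D)"
    using assms by (intro sum_power_gap(2)) (auto simp: open_simplex_def)
  then show ?thesis
    using assms unfolding Z_fun_def
    by (intro mult_nonneg_nonneg sum_nonneg prod_nonneg) (auto simp: open_simplex_def)
qed

lemma sum_prod_eq_Z_fun:
  assumes "x \<in> open_simplex d" "2 \<le> num_leaves D"
  shows "(\<Sum>\<pi>\<in>M. \<Prod>j<d. x j ^ num_leaves (branch d D (\<pi> j))) =
    Z_fun d D M x * (1 - (\<Sum>i<d. x i ^ num_leaves D))"
proof -
  have "0 < 1 - (\<Sum>i<d. x i ^ num_leaves D)"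
    using assms by (intro sum_power_gap(2)) (auto simp: open_simplex_def)
  then show ?thesis by (simp add: Z_fun_def)
qed

lemma Z_fun_le_card:
  assumes "2 \<le> length ds" "length ds \<le> d" "x \<in> open_simplex d"
    and M: "complete_representatives d (Some (Node ds)) M"
  shows "Z_fun d (Some (Node ds)) M x \<le> real (card M)"
proof -
  let ?D = "Some (Node ds)"
  let ?g = "1 - (\<Sum>i<d. x i ^ num_leaves ?D)"
  have x: "\<And>i. i < d \<Longrightarrow> 0 \<le> x i \<and> x i < 1" and s: "(\<Sum>i<d. x i) = 1"
    using assms(3) by (auto simp: open_simplex_def)
  have m: "2 \<le> num_leaves ?D" using assms(1) by (rule num_leaves_ge_2)
  note gap = sum_power_gap[OF x s m]
  have bound: "(\<Prod>j<d. x j ^ num_leaves (branch d ?D (\<pi> j))) \<le> ?g" if "\<pi> \<in> M" for \<pi>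
  proof -
    have p: "\<pi> permutes {..<d}" using M that by (auto simp: complete_representatives_def)
    define i where "i = inv \<pi> 0"
    define j where "j = inv \<pi> 1"
    have pi: "\<pi> i = 0" "\<pi> j = 1" using permutes_inverses(1)[OF p] by (simp_all add: i_def j_def)
    then have "i \<noteq> j" by auto
    have ij: "i < d" "j < d"
      using permutes_in_image[OF p, of i] permutes_in_image[OF p, of j] pi assms by auto
    have e: "1 \<le> num_leaves (branch d ?D (\<pi> l))" if "l \<in> {i, j}" for l
      using that pi assms num_leaves_pos by (auto simp: branch_Node)
    have "(\<Prod>l<d. x l ^ num_leaves (branch d ?D (\<pi> l))) \<le> (\<Prod>l<d. if l \<in> {i, j} then x l else 1)"
    proof (rule prod_mono)
      fix l assume "l \<in> {..<d}"
      then have xl: "0 \<le> x l" "x l \<le> 1" using x[of l] by auto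
      have "x l ^ num_leaves (branch d ?D (\<pi> l)) \<le> (if l \<in> {i, j} then x l else 1)"
        using power_decreasing[OF e xl, of l] xl by (auto simp: power_le_one)
      then show "0 \<le> x l ^ num_leaves (branch d ?D (\<pi> l)) \<and>
          x l ^ num_leaves (branch d ?D (\<pi> l)) \<le> (if l \<in> {i, j} then x l else 1)"
        using xl by simp
    qed
    also have "\<dots> = (\<Prod>l\<in>{..<d} \<inter> {i, j}. x l)"
      by (rule prod.inter_restrict[symmetric]) simp
    also have "{..<d} \<inter> {i, j} = {i, j}" using ij by auto
    also have "(\<Prod>l\<in>{i, j}. x l) = x i * x j" using \<open>i \<noteq> j\<close> by simp
    also have "\<dots> \<le> x i * (1 - x i)"
    proof (rule mult_left_mono)
      have "(\<Sum>l\<in>{i, j}. x l) \<le> (\<Sum>l<d. x l)"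
        using ij x by (intro sum_mono2) auto
      then show "x j \<le> 1 - x i" using s \<open>i \<noteq> j\<close> by simp
    qed (use x ij in auto)
    also have "\<dots> \<le> (\<Sum>l<d. x l * (1 - x l))"
      using x ij by (intro member_le_sum) (auto intro: mult_nonneg_nonneg simp: less_imp_le)
    also have "\<dots> \<le> ?g" by (rule gap(1))
    finally show ?thesis .
  qed
  have "Z_fun d ?D M x * ?g \<le> real (card M) * ?g"
    using sum_bounded_above[of M "\<lambda>\<pi>. \<Prod>j<d. x j ^ num_leaves (branch d ?D (\<pi> j))" ?g, OF bound]
      sum_prod_eq_Z_fun[OF assms(3) m, of M] by simp
  then show ?thesis using gap(2) by simp
qed

lemma num_leaves_branch_less:
  assumes "2 \<le> length ts" "length ts \<le> d" "j < d"
  shows "num_leaves (branch d (Some (Node ts)) j) < num_leaves (Some (Node ts))"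
proof -
  let ?T = "Some (Node ts)"
  define i where "i = (if j = 0 then 1 else 0 :: nat)"
  have i: "i < length ts" "i \<noteq> j" using assms(1) by (auto simp: i_def)
  have "num_leaves (branch d ?T j) < num_leaves (branch d ?T j) + num_leaves (branch d ?T i)"
    using i assms num_leaves_pos[of "ts ! i"] by (simp add: branch_Node)
  also have "\<dots> = (\<Sum>l\<in>{j, i}. num_leaves (branch d ?T l))" using i by simp
  also have "\<dots> \<le> (\<Sum>l<d. num_leaves (branch d ?T l))"
    using i assms by (intro sum_mono2) auto
  also have "\<dots> = num_leaves ?T"
    using num_leaves_branch[of ts d] assms by (cases ts) auto
  finally show ?thesis .
qed

lemma tree_count_upper:
  fixes Zs :: real
  assumes d: "2 \<le> d" and lds: "2 \<le> length ds" "length ds \<le> d" and D: "dary d (Some (Node ds))"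
    and M: "complete_representatives d (Some (Node ds)) M"
    and Zs: "0 \<le> Zs" "\<And>x. x \<in> open_simplex d \<Longrightarrow> Z_fun d (Some (Node ds)) M x \<le> Zs"
    and T: "dary d T"
  defines "D \<equiv> Some (Node ds)"
  defines "P \<equiv> (\<Prod>i<d. inducibility d (branch d D i)) / (\<Prod>i<d. fact (num_leaves (branch d D i)))"
  shows "real (tree_count D T) \<le> P * Zs * real (num_leaves T) ^ num_leaves D"
proof -
  let ?m = "num_leaves D"
  have m: "2 \<le> ?m" unfolding D_def using lds(1) by (rule num_leaves_ge_2)
  have None: "tree_count D None = 0"
    by (simp add: D_def tree_count_eq_card_copies copies_None_right)
  have Db: "dary d (branch d D i)" if "i < d" for i
    using dary_branch[OF D that] by (simp add: D_def)
  have P: "0 \<le> P"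
    unfolding P_def using Db inducibility_nonneg[OF d]
    by (intro divide_nonneg_nonneg prod_nonneg) auto
  have "real (tree_count D (Some t)) \<le> P * Zs * real (num_leaves (Some t)) ^ ?m" if "dary d (Some t)" for t
    using that
  proof (induction t)
    case (Node ts)
    let ?T = "Some (Node ts)"
    let ?n = "num_leaves ?T"
    have n: "0 < ?n" using num_leaves_pos[of "Node ts"] by simp
    show ?case
    proof (cases "ts = []")
      case True
      have "tree_count D ?T \<le> 1 choose ?m"
        using tree_count_le_binomial[of D ?T] True by simp
      then have "tree_count D ?T = 0" using m by (simp add: binomial_eq_0)
      then show ?thesis using P Zs(1) by simp
    next
      case False
      have lts: "2 \<le> length ts" "length ts \<le> d"
        using Node.prems False unfolding dary_Node by auto
      let ?nn = "\<lambda>j. num_leaves (branch d ?T j)"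
      define x where "x j = real (?nn j) / real ?n" for j
      have nx: "real (?nn j) = real ?n * x j" for j using n by (simp add: x_def)
      have "(\<Sum>j<d. x j) = real (\<Sum>j<d. ?nn j) / real ?n"
        by (simp add: x_def sum_divide_distrib)
      then have "(\<Sum>j<d. x j) = 1"
        using n by (simp only: num_leaves_branch[OF False lts(2), symmetric]) simp
      moreover have "0 \<le> x j \<and> x j < 1" if "j < d" for j
        using num_leaves_branch_less[OF lts that] n by (simp add: x_def)
      ultimately have xs: "x \<in> open_simplex d" by (simp add: open_simplex_def)
      let ?s = "\<Sum>j<d. x j ^ ?m"
      have IH: "real (tree_count D (branch d ?T j)) \<le> P * Zs * real (?nn j) ^ ?m" if "j < d" for j
      proof (cases "j < length ts")
        case True
        then have "dary d (Some (ts ! j))" using Node.prems unfolding dary_Node by auto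
        then show ?thesis using Node.IH[of "ts ! j"] True that lts by (simp add: branch_Node)
      next
        case False
        then show ?thesis using that lts None P Zs by (simp add: branch_Node)
      qed
      have prod: "(\<Prod>j<d. real (tree_count (branch d D (\<pi> j)) (branch d ?T j))) \<le>
          P * real ?n ^ ?m * (\<Prod>j<d. x j ^ num_leaves (branch d D (\<pi> j)))" if "\<pi> \<in> M" for \<pi>
      proof -
        have p: "\<pi> permutes {..<d}" using M that by (auto simp: complete_representatives_def)
        let ?e = "\<lambda>j. num_leaves (branch d D j)"
        have e: "?m = (\<Sum>j<d. ?e (\<pi> j))"
          using sum.permute[OF p, of ?e] num_leaves_branch[of ds d] lds
          by (cases ds) (simp_all add: D_def comp_def)
        have "(\<Prod>j<d. real (tree_count (branch d D (\<pi> j)) (branch d ?T j))) \<le>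
            (\<Prod>j<d. inducibility d (branch d D (\<pi> j)) * real (?nn j) ^ ?e (\<pi> j) / fact (?e (\<pi> j)))"
        proof (intro prod_mono conjI tree_count_le_inducibility[OF d])
          fix j assume "j \<in> {..<d}"
          then have "j < d" "\<pi> j < d" using permutes_in_image[OF p, of j] by auto
          then show "dary d (branch d D (\<pi> j))" "dary d (branch d ?T j)"
            using Db dary_branch[OF Node.prems] by auto
        qed simp
        also have "\<dots> = (\<Prod>j<d. inducibility d (branch d D (\<pi> j)) / fact (?e (\<pi> j))) *
            (\<Prod>j<d. real ?n ^ ?e (\<pi> j)) * (\<Prod>j<d. x j ^ ?e (\<pi> j))"
          unfolding nx power_mult_distrib by (simp add: prod.distrib[symmetric] mult.assoc del: prod_dividef)
        also have "(\<Prod>j<d. inducibility d (branch d D (\<pi> j)) / fact (?e (\<pi> j))) = P"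
          using prod.permute[OF p, of "\<lambda>j. inducibility d (branch d D j) / fact (?e j)"]
          by (simp add: P_def comp_def prod_dividef)
        also have "(\<Prod>j<d. real ?n ^ ?e (\<pi> j)) = real ?n ^ ?m"
          by (simp add: e power_sum)
        finally show ?thesis .
      qed
      have "real (tree_count D ?T) = (\<Sum>j<d. real (tree_count D (branch d ?T j))) +
          (\<Sum>\<pi>\<in>M. \<Prod>j<d. real (tree_count (branch d D (\<pi> j)) (branch d ?T j)))"
        using tree_count_Node[OF False lts(2) lds M] by (simp add: D_def)
      also have "\<dots> \<le> (\<Sum>j<d. P * Zs * real (?nn j) ^ ?m) +
          (\<Sum>\<pi>\<in>M. P * real ?n ^ ?m * (\<Prod>j<d. x j ^ num_leaves (branch d D (\<pi> j))))"
        using IH prod by (intro add_mono sum_mono) auto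
      also have "\<dots> = P * real ?n ^ ?m * (Zs * ?s + Z_fun d D M x * (1 - ?s))"
        unfolding nx power_mult_distrib sum_distrib_left[symmetric] sum_prod_eq_Z_fun[OF xs m]
        by (simp add: sum_distrib_left algebra_simps)
      also have "\<dots> \<le> P * real ?n ^ ?m * (Zs * ?s + Zs * (1 - ?s))"
      proof (intro mult_left_mono add_left_mono mult_right_mono)
        show "Z_fun d D M x \<le> Zs" using Zs(2)[OF xs] by (simp add: D_def)
        show "0 \<le> 1 - ?s"
          using sum_power_gap(2)[of d x ?m] xs m by (auto simp: open_simplex_def)
        show "0 \<le> P * real ?n ^ ?m" using P by simp
      qed
      also have "\<dots> = P * Zs * real ?n ^ ?m" by (simp add: algebra_simps)
      finally show ?thesis .
    qed
  qed
  then show ?thesis using T None P Zs(1) by (cases T) auto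
qed

theorem proposition3:
  fixes d :: nat and D :: dtree and M :: "(nat \<Rightarrow> nat) set"
  assumes "d \<ge> 2"
    and "dary d D"
    and "num_leaves D \<ge> 2"
    and "complete_representatives d D M"
  shows "inducibility d D \<le>
    (fact (num_leaves D) / (\<Prod>i<d. fact (num_leaves (branch d D i)))) *
    (\<Prod>i<d. inducibility d (branch d D i)) *
    (SUP x \<in> {x. (\<forall>i<d. 0 \<le> x i \<and> x i < 1) \<and> (\<Sum>i<d. x i) = 1}. Z_fun d D M x)"
proof -
  obtain t where "D = Some t" using assms(3) by (cases D) auto
  then obtain ds where D: "D = Some (Node ds)" by (cases t) auto
  have "ds \<noteq> []" using assms(3) D by auto
  then have lds: "2 \<le> length ds" "length ds \<le> d" using assms(2) unfolding D dary_Node by auto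
  define Zs where "Zs = (SUP x \<in> open_simplex d. Z_fun d D M x)"
  have bdd: "bdd_above (Z_fun d D M ` open_simplex d)"
    unfolding D by (rule bdd_aboveI2, rule Z_fun_le_card[OF lds _ assms(4)[unfolded D]])
  have up: "Z_fun d D M x \<le> Zs" if "x \<in> open_simplex d" for x
    unfolding Zs_def by (rule cSUP_upper[OF that bdd])
  have "(\<lambda>_. 1 / real d) \<in> open_simplex d" using assms(1) by (simp add: open_simplex_def)
  then have Zs: "0 \<le> Zs" using Z_fun_nonneg[OF _ assms(3)] up order_trans by blast
  let ?P = "(\<Prod>i<d. inducibility d (branch d D i)) / (\<Prod>i<d. fact (num_leaves (branch d D i)))"
  have "0 \<le> ?P"
    using inducibility_nonneg[OF assms(1)] dary_branch assms(2) unfolding D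
    by (intro divide_nonneg_nonneg prod_nonneg) auto
  then have "inducibility d D \<le> ?P * Zs * fact (num_leaves D)"
  proof (intro inducibility_upper[OF assms(1)] mult_nonneg_nonneg)
    fix T assume "dary d T"
    then show "real (tree_count D T) \<le>
        ?P * Zs * fact (num_leaves D) * real (num_leaves T) ^ num_leaves D / fact (num_leaves D)"
      using tree_count_upper[OF assms(1) lds assms(2)[unfolded D] assms(4)[unfolded D] Zs up[unfolded D], folded D, of T]
      by (simp add: mult.assoc)
  qed (use Zs D in auto)
  then show ?thesis by (simp add: Zs_def open_simplex_def mult_ac)
qed

end
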